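(* Let $k$ be a field of characteristic zero and $\mathcal{A}=k[x^{\pm1}]$. For $n\geq 0$ let $$\alpha_n=\tfrac12\left((x^{-1}\otimes x)^{\otimes n}-(x\otimes x^{-1})^{\otimes n}\right)\in C_{2n-1}(\mathcal{A})\quad (n\ge 1),\qquad \alpha_0=0,$$ in the normalized Hochschild complex. Then $$\alpha=\sum_{m\geq0} m!\,u^m\alpha_{m+1}$$ satisfies $(b-uB)(\alpha)=0$, and its image $\alpha_1=\frac12(x^{-1}\otimes x-x\otimes x^{-1})$ in Hochschild homology is non-degenerate. Hence $\alpha$ defines a $1$-Calabi--Yau structure on $\mathcal{A}$; under the Hochschild--Kostant--Rosenberg identification $HH_1(\mathcal{A})\simeq\Omega^1_{\mathcal{A}}$, the class of $\alpha_1$ is $x^{-1}d_{dR}x$.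
   Context: The normalized Hochschild complex is $C_n(\mathcal{A})=\mathcal{A}\otimes\bar{\mathcal{A}}^{\otimes n}$, $\bar{\mathcal{A}}=\mathcal{A}/k$, with Hochschild differential $b$ and Connes operator $$B(x_0\otimes\dots\otimes x_n)=\sum_{i=0}^n(-1)^{ni}\,1\otimes x_i\otimes\dots\otimes x_n\otimes x_0\otimes\dots\otimes x_{i-1}.$$ The negative cyclic complex $HC^-(\mathcal{A})$ consists of formal power series in a variable $u$ of cohomological degree $2$ with coefficients in the Hochschild complex, with differential $b-uB$; the natural map $(-)^\natural:HC^-\to HH$ is $u\mapsto 0$. The HKR map in degree $1$ is $a\otimes b\mapsto a\,d_{dR}b$. For a smooth dg-category (or algebra) $\mathcal{A}$ put $\mathcal{A}^e=\mathcal{A}\otimes\mathcal{A}^{op}$ and $\mathcal{A}^\vee=\mathbb{R}\mathrm{Hom}_{\mathcal{A}^e}(\mathcal{A},\mathcal{A}^e)$. There is an equivalence $(-)^\flat:HH(\mathcal{A})\simeq\mathbb{R}\mathrm{Hom}_{\mathcal{A}^e}(\mathcal{A}^\vee,\mathcal{A})$. A class $c:k[n]\to HH(\mathcal{A})$ is non-degenerate if $c^\flat:\mathcal{A}^\vee[n]\to\mathcal{A}$ is an equivalence; an $n$-Calabi--Yau structure is a class $c:k[n]\to HC^-(\mathcal{A})$ with $c^\natural$ non-degenerate. *)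

theory Defs
  imports
    "HOL-Library.Poly_Mapping"
    "HOL-Library.Function_Algebras"
    "HOL-Computational_Algebra.Formal_Power_Series"
begin

(* Quotients are handled through representatives: a quotient space U / U0 is given by a
   subspace U of some ambient group together with the subspace U0 of elements that
   represent zero.  Tensor products over k are presented by generators and relations: the
   ambient space is the free vector space 'x \<Rightarrow>\<^sub>0 'k on the set of pure tensors (lists or
   pairs), and the null space is the linear span of the multilinearity relations. *)

definition fscale :: "'k::field \<Rightarrow> ('x \<Rightarrow>\<^sub>0 'k) \<Rightarrow> ('x \<Rightarrow>\<^sub>0 'k)" where
  "fscale c p = Poly_Mapping.map ((*) c) p"

definition lin_ext :: "('k::field \<Rightarrow> 'v \<Rightarrow> 'v) \<Rightarrow> ('x \<Rightarrow> 'v::comm_monoid_add) \<Rightarrow> ('x \<Rightarrow>\<^sub>0 'k) \<Rightarrow> 'v" where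
  "lin_ext s f p = (\<Sum>x\<in>Poly_Mapping.keys p. s (Poly_Mapping.lookup p x) (f x))"

definition signed :: "nat \<Rightarrow> 'v::ab_group_add \<Rightarrow> 'v" where
  "signed i v = (if even i then v else - v)"

(* f induces a well-defined bijection U / U0 \<rightarrow> V / V0. *)
definition induces_bij ::
  "('u::ab_group_add \<Rightarrow> 'v::ab_group_add) \<Rightarrow> 'u set \<Rightarrow> 'u set \<Rightarrow> 'v set \<Rightarrow> 'v set \<Rightarrow> bool" where
  "induces_bij f U U0 V V0 \<longleftrightarrow>
     (\<forall>u\<in>U. f u \<in> V) \<and>
     (\<forall>u\<in>U. \<forall>u'\<in>U. u - u' \<in> U0 \<longleftrightarrow> f u - f u' \<in> V0) \<and>
     (\<forall>v\<in>V. \<exists>u\<in>U. f u - v \<in> V0)"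

(* (a0,...,an) \<mapsto> (a0,...,ai * a(i+1),...,an) *)
definition merge_adjacent :: "nat \<Rightarrow> 'a::times list \<Rightarrow> 'a list" where
  "merge_adjacent i as = take i as @ [as ! i * as ! Suc i] @ drop (i + 2) as"

(* The bimodule bcar / bnull, with left action lact and right action ract. *)
record ('a, 'm) bimod =
  bcar :: "'m set"
  bnull :: "'m set"
  lact :: "'a \<Rightarrow> 'm \<Rightarrow> 'm"
  ract :: "'a \<Rightarrow> 'm \<Rightarrow> 'm"

definition bcong :: "('a, 'm::ab_group_add) bimod \<Rightarrow> 'm \<Rightarrow> 'm \<Rightarrow> bool" where
  "bcong M v w \<longleftrightarrow> v - w \<in> bnull M"

definition bimod_hom ::
  "('a, 'm::ab_group_add) bimod \<Rightarrow> ('a, 'n::ab_group_add) bimod \<Rightarrow> ('m \<Rightarrow> 'n) \<Rightarrow> bool" where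
  "bimod_hom M N f \<longleftrightarrow>
     (\<forall>v\<in>bcar M. f v \<in> bcar N) \<and>
     (\<forall>v\<in>bcar M. \<forall>w\<in>bcar M. bcong M v w \<longrightarrow> bcong N (f v) (f w)) \<and>
     (\<forall>v\<in>bcar M. \<forall>w\<in>bcar M. bcong N (f (v + w)) (f v + f w)) \<and>
     (\<forall>a. \<forall>v\<in>bcar M. bcong N (f (lact M a v)) (lact N a (f v))) \<and>
     (\<forall>a. \<forall>v\<in>bcar M. bcong N (f (ract M a v)) (ract N a (f v)))"

definition diag_bimod :: "('a, 'a::ring_1) bimod" where
  "diag_bimod = \<lparr>bcar = UNIV, bnull = {0}, lact = (\<lambda>a v. a * v), ract = (\<lambda>a v. v * a)\<rparr>"

locale k_algebra = vector_space scale
  for scale :: "'k::field \<Rightarrow> 'a::ring_1 \<Rightarrow> 'a" (infixr \<open>*s\<close> 75) +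
  assumes scale_mult_left: "(c *s a) * b = c *s (a * b)"
    and scale_mult_right: "a * (c *s b) = c *s (a * b)"
begin

subsection \<open>The normalized Hochschild complex and the negative cyclic complex\<close>

(* The relations of the direct sum over n of A \<otimes> (A/k)^{\<otimes>n}; the last family kills the
   tensors that have a scalar in some position other than the first. *)
definition hh_relators :: "('a list \<Rightarrow>\<^sub>0 'k) set" where
  "hh_relators =
     {Poly_Mapping.single (as[i := a + a']) 1
        - Poly_Mapping.single (as[i := a]) 1 - Poly_Mapping.single (as[i := a']) 1
        | as i a a'. i < length as}
     \<union> {Poly_Mapping.single (as[i := c *s a]) 1 - Poly_Mapping.single (as[i := a]) c
        | as i c a. i < length as}
     \<union> {Poly_Mapping.single (as[i := c *s 1]) 1 | as i c. 0 < i \<and> i < length as}"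

definition hh_null :: "('a list \<Rightarrow>\<^sub>0 'k) set" where
  "hh_null = module.span fscale hh_relators"

(* C_n, for n an integer; zero for n < 0. *)
definition hh_chains :: "int \<Rightarrow> ('a list \<Rightarrow>\<^sub>0 'k) set" where
  "hh_chains n = {p. \<forall>as\<in>Poly_Mapping.keys p. as \<noteq> [] \<and> int (length as) = n + 1}"

definition hh_b :: "('a list \<Rightarrow>\<^sub>0 'k) \<Rightarrow> ('a list \<Rightarrow>\<^sub>0 'k)" where
  "hh_b = lin_ext fscale (\<lambda>as.
     let n = length as - 1 in
     if n = 0 then 0
     else (\<Sum>i<n. signed i (Poly_Mapping.single (merge_adjacent i as) 1))
          + signed n (Poly_Mapping.single ((last as * hd as) # butlast (tl as)) 1))"

definition connes_B :: "('a list \<Rightarrow>\<^sub>0 'k) \<Rightarrow> ('a list \<Rightarrow>\<^sub>0 'k)" where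
  "connes_B = lin_ext fscale (\<lambda>as.
     let n = length as - 1 in
     \<Sum>i\<le>n. signed (n * i) (Poly_Mapping.single (1 # drop i as @ take i as) 1))"

definition hh_cycles :: "int \<Rightarrow> ('a list \<Rightarrow>\<^sub>0 'k) set" where
  "hh_cycles n = {p \<in> hh_chains n. hh_b p \<in> hh_null}"

definition hh_boundaries :: "int \<Rightarrow> ('a list \<Rightarrow>\<^sub>0 'k) set" where
  "hh_boundaries n = {p \<in> hh_chains n. \<exists>q\<in>hh_chains (n + 1). p - hh_b q \<in> hh_null}"

(* A power series in u is homogeneous of homological degree n if its coefficient of u^m lies
   in C_{n+2m}, because u has homological degree -2. *)
definition hcn_chains :: "int \<Rightarrow> ('a list \<Rightarrow>\<^sub>0 'k) fps set" where
  "hcn_chains n = {c. \<forall>m. fps_nth c m \<in> hh_chains (n + 2 * int m)}"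

definition hcn_null :: "('a list \<Rightarrow>\<^sub>0 'k) fps set" where
  "hcn_null = {c. \<forall>m. fps_nth c m \<in> hh_null}"

(* b - u B *)
definition hcn_diff :: "('a list \<Rightarrow>\<^sub>0 'k) fps \<Rightarrow> ('a list \<Rightarrow>\<^sub>0 'k) fps" where
  "hcn_diff c = Abs_fps (\<lambda>m.
     hh_b (fps_nth c m) - (if m = 0 then 0 else connes_B (fps_nth c (m - 1))))"

definition hcn_cycles :: "int \<Rightarrow> ('a list \<Rightarrow>\<^sub>0 'k) fps set" where
  "hcn_cycles n = {c \<in> hcn_chains n. hcn_diff c \<in> hcn_null}"

(* The map u \<mapsto> 0. *)
definition hcn_natural :: "('a list \<Rightarrow>\<^sub>0 'k) fps \<Rightarrow> ('a list \<Rightarrow>\<^sub>0 'k)" where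
  "hcn_natural c = fps_nth c 0"

subsection \<open>Bimodules and smoothness\<close>

(* Modules over A^e = A \<otimes> A^op are bimodules on which the two actions of k agree. *)
definition is_bimodule :: "('a, 'm::ab_group_add) bimod \<Rightarrow> bool" where
  "is_bimodule M \<longleftrightarrow>
     bnull M \<subseteq> bcar M \<and>
     (\<forall>S\<in>{bcar M, bnull M}.
        0 \<in> S \<and> (\<forall>v\<in>S. \<forall>w\<in>S. v - w \<in> S) \<and> (\<forall>a. \<forall>v\<in>S. lact M a v \<in> S \<and> ract M a v \<in> S)) \<and>
     (\<forall>v\<in>bcar M. bcong M (lact M 1 v) v \<and> bcong M (ract M 1 v) v) \<and>
     (\<forall>a b. \<forall>v\<in>bcar M.
        bcong M (lact M (a * b) v) (lact M a (lact M b v)) \<and>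
        bcong M (ract M (a * b) v) (ract M b (ract M a v)) \<and>
        bcong M (lact M a (ract M b v)) (ract M b (lact M a v)) \<and>
        bcong M (lact M (a + b) v) (lact M a v + lact M b v) \<and>
        bcong M (ract M (a + b) v) (ract M a v + ract M b v)) \<and>
     (\<forall>a. \<forall>v\<in>bcar M. \<forall>w\<in>bcar M.
        bcong M (lact M a (v + w)) (lact M a v + lact M a w) \<and>
        bcong M (ract M a (v + w)) (ract M a v + ract M a w)) \<and>
     (\<forall>c. \<forall>v\<in>bcar M. bcong M (lact M (c *s 1) v) (ract M (c *s 1) v))"

definition env_relators :: "('a \<times> 'a \<Rightarrow>\<^sub>0 'k) set" where
  "env_relators =
     {Poly_Mapping.single (a + a', b) 1
        - Poly_Mapping.single (a, b) 1 - Poly_Mapping.single (a', b) 1 | a a' b. True}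
     \<union> {Poly_Mapping.single (a, b + b') 1
        - Poly_Mapping.single (a, b) 1 - Poly_Mapping.single (a, b') 1 | a b b'. True}
     \<union> {Poly_Mapping.single (c *s a, b) 1 - Poly_Mapping.single (a, b) c | a b c. True}
     \<union> {Poly_Mapping.single (a, c *s b) 1 - Poly_Mapping.single (a, b) c | a b c. True}"

(* A^e as a left module over itself, that is, A \<otimes> A with the outer bimodule structure
   x (a \<otimes> b) y = x a \<otimes> b y. *)
definition env :: "('a, 'a \<times> 'a \<Rightarrow>\<^sub>0 'k) bimod" where
  "env = \<lparr>bcar = UNIV, bnull = module.span fscale env_relators,
     lact = (\<lambda>x. lin_ext fscale (\<lambda>(a, b). Poly_Mapping.single (x * a, b) 1)),
     ract = (\<lambda>y. lin_ext fscale (\<lambda>(a, b). Poly_Mapping.single (a, b * y) 1))\<rparr>"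

(* (A^e)^m *)
definition free_bimod :: "nat \<Rightarrow> ('a, nat \<Rightarrow> ('a \<times> 'a \<Rightarrow>\<^sub>0 'k)) bimod" where
  "free_bimod m = \<lparr>bcar = {v. \<forall>j\<ge>m. v j = 0},
     bnull = {v. (\<forall>j\<ge>m. v j = 0) \<and> (\<forall>j<m. v j \<in> bnull env)},
     lact = (\<lambda>a v j. lact env a (v j)),
     ract = (\<lambda>a v j. ract env a (v j))\<rparr>"

(* Finitely generated projective: a direct summand of some (A^e)^m. *)
definition fg_projective :: "('a, 'm::ab_group_add) bimod \<Rightarrow> bool" where
  "fg_projective M \<longleftrightarrow> is_bimodule M \<and>
     (\<exists>m s p. bimod_hom M (free_bimod m) s \<and> bimod_hom (free_bimod m) M p \<and>
        (\<forall>v\<in>bcar M. bcong M (p (s v)) v))"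

(* A is perfect over A^e: it has a resolution of finite length
     0 \<rightarrow> P N \<rightarrow> ... \<rightarrow> P 1 \<rightarrow> P 0 \<rightarrow> A \<rightarrow> 0
   by finitely generated projective A^e-modules.  Fixing the type of the elements of P i is
   harmless, because every such module is isomorphic to a submodule of some (A^e)^m. *)
definition smooth :: bool where
  "smooth \<longleftrightarrow>
     (\<exists>(P :: nat \<Rightarrow> ('a, nat \<Rightarrow> ('a \<times> 'a \<Rightarrow>\<^sub>0 'k)) bimod) d \<epsilon> N.
        (\<forall>i. fg_projective (P i)) \<and>
        (\<forall>i>N. bcar (P i) \<subseteq> bnull (P i)) \<and>
        bimod_hom (P 0) diag_bimod \<epsilon> \<and>
        (\<forall>i. bimod_hom (P (Suc i)) (P i) (d i)) \<and>
        (\<forall>a. \<exists>v\<in>bcar (P 0). \<epsilon> v = a) \<and>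
        (\<forall>v\<in>bcar (P 0). \<epsilon> v = 0 \<longleftrightarrow> (\<exists>w\<in>bcar (P 1). bcong (P 0) (d 0 w) v)) \<and>
        (\<forall>i. \<forall>v\<in>bcar (P (Suc i)).
           bcong (P i) (d i v) 0 \<longleftrightarrow> (\<exists>w\<in>bcar (P (Suc (Suc i))). bcong (P (Suc i)) (d (Suc i) w) v)))"

subsection \<open>The derived dual and non-degeneracy\<close>

(* RHom_{A^e}(A, M) computed by the normalized bar resolution A \<otimes> (A/k)^{\<otimes>p} \<otimes> A of A, so
   that in degree p it is Hom_{A^e}(A \<otimes> (A/k)^{\<otimes>p} \<otimes> A, M) = Hom_k((A/k)^{\<otimes>p}, M). *)
definition cochains :: "('a, 'm::ab_group_add) bimod \<Rightarrow> int \<Rightarrow> ('a list \<Rightarrow> 'm) set" where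
  "cochains M p = {\<phi>.
     (\<forall>as. \<phi> as \<in> bcar M) \<and>
     (\<forall>as. int (length as) \<noteq> p \<longrightarrow> \<phi> as = 0) \<and>
     (\<forall>as i a a'. i < length as \<longrightarrow>
        bcong M (\<phi> (as[i := a + a'])) (\<phi> (as[i := a]) + \<phi> (as[i := a']))) \<and>
     (\<forall>as i c a. i < length as \<longrightarrow>
        bcong M (\<phi> (as[i := c *s a])) (lact M (c *s 1) (\<phi> (as[i := a])))) \<and>
     (\<forall>as i c. i < length as \<longrightarrow> bcong M (\<phi> (as[i := c *s 1])) 0)}"

definition cochain_diff :: "('a, 'm::ab_group_add) bimod \<Rightarrow> ('a list \<Rightarrow> 'm) \<Rightarrow> ('a list \<Rightarrow> 'm)" where
  "cochain_diff M \<phi> = (\<lambda>as.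
     if as = [] then 0
     else let p = length as - 1 in
       lact M (hd as) (\<phi> (tl as))
       + (\<Sum>i<p. signed (Suc i) (\<phi> (merge_adjacent i as)))
       + signed (Suc p) (ract M (last as) (\<phi> (butlast as))))"

definition cocycles :: "('a, 'm::ab_group_add) bimod \<Rightarrow> int \<Rightarrow> ('a list \<Rightarrow> 'm) set" where
  "cocycles M p = {\<phi> \<in> cochains M p. \<forall>as. bcong M (cochain_diff M \<phi> as) 0}"

definition coboundaries :: "('a, 'm::ab_group_add) bimod \<Rightarrow> int \<Rightarrow> ('a list \<Rightarrow> 'm) set" where
  "coboundaries M p =
     {\<phi> \<in> cochains M p. \<exists>\<psi>\<in>cochains M (p - 1). \<forall>as. bcong M (\<phi> as) (cochain_diff M \<psi> as)}"

(* The morphism c^flat : A^dual[n] \<rightarrow> A attached to a cycle c of degree n, with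
   A^dual = RHom_{A^e}(A, A^e) given by cochains with values in env.  The class c lives in
   A \<otimes>_{A^e} Bar(A), and a cochain \<phi> : Bar(A) \<rightarrow> A^e sends it into A \<otimes>_{A^e} A^e = A, where
   a0 \<otimes> (u \<otimes> v) corresponds to v a0 u.  Thus c^flat(\<phi>) is the image of
   a0 \<otimes> \<phi>(a1,...,an).  It is zero on cochains of degree different from n. *)
definition flat :: "('a list \<Rightarrow>\<^sub>0 'k) \<Rightarrow> ('a list \<Rightarrow> ('a \<times> 'a \<Rightarrow>\<^sub>0 'k)) \<Rightarrow> 'a" where
  "flat c \<phi> = lin_ext (*s) (\<lambda>as. lin_ext (*s) (\<lambda>(u, v). v * hd as * u) (\<phi> (tl as))) c"

(* c^flat is an equivalence in the derived category iff it is a quasi-isomorphism from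
   A^dual[n] to A placed in degree 0; note H^p(A^dual[n]) = H^{p+n}(A^dual). *)
definition nondegenerate :: "int \<Rightarrow> ('a list \<Rightarrow>\<^sub>0 'k) \<Rightarrow> bool" where
  "nondegenerate n c \<longleftrightarrow> c \<in> hh_cycles n \<and>
     (\<forall>p. induces_bij (flat c) (cocycles env (p + n)) (coboundaries env (p + n))
            (if p = 0 then UNIV else {0}) {0})"

(* The class of c in negative cyclic homology is an n-Calabi-Yau structure. *)
definition calabi_yau_structure :: "int \<Rightarrow> ('a list \<Rightarrow>\<^sub>0 'k) fps \<Rightarrow> bool" where
  "calabi_yau_structure n c \<longleftrightarrow>
     smooth \<and> c \<in> hcn_cycles n \<and> nondegenerate n (hcn_natural c)"

end

subsection \<open>Kaehler differentials and the HKR map\<close>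

locale comm_k_algebra = k_algebra scale
  for scale :: "'k::field \<Rightarrow> 'a::comm_ring_1 \<Rightarrow> 'a" (infixr \<open>*s\<close> 75)
begin

(* Omega^1 is the free A-module 'a \<Rightarrow>\<^sub>0 'a on the symbols d b, represented by
   Poly_Mapping.single b 1, modulo the A-submodule kahler_null. *)
definition kahler_null :: "('a \<Rightarrow>\<^sub>0 'a) set" where
  "kahler_null = module.span (\<lambda>a. Poly_Mapping.map ((*) a))
     ({Poly_Mapping.single (a + b) 1 - Poly_Mapping.single a 1 - Poly_Mapping.single b 1 | a b. True}
      \<union> {Poly_Mapping.single (a * b) 1 - Poly_Mapping.single b a - Poly_Mapping.single a b | a b. True}
      \<union> {Poly_Mapping.single (c *s 1) 1 | c. True})"

(* a \<otimes> b \<mapsto> a d b, on chains of degree 1 *)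
definition hkr1 :: "('a list \<Rightarrow>\<^sub>0 'k) \<Rightarrow> ('a \<Rightarrow>\<^sub>0 'a)" where
  "hkr1 p = (\<Sum>as\<in>Poly_Mapping.keys p.
     Poly_Mapping.single (as ! 1) (Poly_Mapping.lookup p as *s (as ! 0)))"

end

subsection \<open>Laurent polynomials\<close>

(* The group ring of the integers; multiplication of Poly_Mapping is convolution. *)
type_synonym 'k laurent = "int \<Rightarrow>\<^sub>0 'k"

definition x_gen :: "'k::field laurent" where
  "x_gen = Poly_Mapping.single 1 1"

definition x_inv :: "'k::field laurent" where
  "x_inv = Poly_Mapping.single (- 1) 1"

lemma lookup_fscale [simp]: "Poly_Mapping.lookup (fscale c p) x = c * Poly_Mapping.lookup p x"
  by (simp add: fscale_def Poly_Mapping.map.rep_eq when_def)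

lemma fscale_eq_mult: "fscale c p = Poly_Mapping.single 0 c * (p :: 'k::field laurent)"
  by (rule poly_mapping_eqI) (simp add: fscale_def map_eq_zero_iff mult_map_scale_conv_mult)

interpretation laurent: comm_k_algebra "fscale :: 'k::field \<Rightarrow> 'k laurent \<Rightarrow> 'k laurent"
proof
qed (auto simp: fscale_eq_mult ac_simps distrib_left distrib_right single_add mult_single)

definition alpha :: "nat \<Rightarrow> ('k::field laurent list \<Rightarrow>\<^sub>0 'k)" where
  "alpha n = (if n = 0 then 0 else
     fscale (1 / 2)
       (Poly_Mapping.single (concat (replicate n [x_inv, x_gen])) 1
        - Poly_Mapping.single (concat (replicate n [x_gen, x_inv])) 1))"

definition alpha_series :: "('k::field_char_0 laurent list \<Rightarrow>\<^sub>0 'k) fps" where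
  "alpha_series = Abs_fps (\<lambda>m. fscale (fact m) (alpha (m + 1)))"

end

(* The identity m b(alpha_{m+1}) = B(alpha_m) holds because in an alternating tensor of x and
   1/x every inner face contains a unit in a reduced position, while cyclic rotations just
   exchange the two alternating tensors.

   A \<otimes> A is a Laurent polynomial ring over A, in which x \<otimes> 1 - 1 \<otimes> x is a nonzero divisor
   generating the kernel of multiplication.  Hence H^0(A, A \<otimes> A) = 0.  A cocycle of degree at least 2
   is cobounded by solving a recursion in its first argument.  In degree 1 a cocycle is a derivation D,
   determined by D(x), and pairing it with alpha_1 gives 1/x times the image of D(x) under
   multiplication; so H^1 is A via this pairing.

   For any commutative algebra, a d b \<mapsto> a \<otimes> b inverts the HKR map in degree 1, because the
   Leibniz relation is the boundary of c \<otimes> a \<otimes> b. *)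
theory Submission
  imports Defs
begin

section \<open>Linear extension\<close>

text \<open>Spaces are given by representatives, and each natural inverse map
  (\<open>kahler_to_chain\<close>, \<open>ring_to_env\<close>) turns a coefficient in A into an
  entry of a pure tensor, so it is additive only modulo the null space. For A \<otimes> A this is
  settled once, by \<open>env_null_iff\<close>: congruences in \<open>env\<close> become equations
  between Laurent polynomials over A. That ring is a commutative domain, so x \<otimes> 1 - 1
  \<otimes> x cancels as soon as it is nonzero, and both actions become multiplications. The
  recursion for a primitive G of F is forced: let G vanish when its first argument is x, and ask
  that the coboundary of G agree with F there; what remains is G(x b, ...) = x G(b, ...) - F(x, b,
  ...). Agreement at all other first arguments is then a consequence of the cocycle identity.
  Surjectivity in degree 1 needs one derivation with value 1 at x, the difference quotient (a
  \<otimes> 1 - 1 \<otimes> a) / (x \<otimes> 1 - 1 \<otimes> x). The factors m! of the series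
  absorb the ratio m between B(alpha_m) and b(alpha_{m+1}), because (m-1)! m = m!.\<close>

interpretation fs: vector_space "fscale :: 'k::field \<Rightarrow> ('x \<Rightarrow>\<^sub>0 'k) \<Rightarrow> ('x \<Rightarrow>\<^sub>0 'k)"
  by standard (auto intro!: poly_mapping_eqI simp: lookup_add algebra_simps)

lemma fscale_single [simp]: "fscale c (Poly_Mapping.single x d) = Poly_Mapping.single x (c * d)"
  by (auto intro!: poly_mapping_eqI simp: lookup_single when_def)

lemma poly_mapping_eq_sum:
  "p = (\<Sum>x\<in>Poly_Mapping.keys p. Poly_Mapping.single x (Poly_Mapping.lookup p x))"
  by (rule poly_mapping_eqI)
    (simp add: lookup_sum lookup_single when_def in_keys_iff sum.delta)

lemma poly_mapping_single_induct [case_names zero single add]: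
  assumes "P 0" "\<And>x c. P (Poly_Mapping.single x c)" "\<And>p q. P p \<Longrightarrow> P q \<Longrightarrow> P (p + q)"
  shows "P (p :: 'x \<Rightarrow>\<^sub>0 'c::comm_monoid_add)"
proof -
  have "P (\<Sum>x\<in>K. Poly_Mapping.single x (Poly_Mapping.lookup p x))" if "finite K" for K
    using that by induction (auto intro: assms)
  then show ?thesis by (metis finite_keys poly_mapping_eq_sum)
qed

text \<open>The defining sum runs over the support, which may shrink by cancellation; a larger
  finite index set can be shared by several arguments.\<close>

lemma lin_ext_superset:
  assumes "module s" "finite K" "Poly_Mapping.keys p \<subseteq> K"
  shows "lin_ext s f p = (\<Sum>x\<in>K. s (Poly_Mapping.lookup p x) (f x))"
proof -
  interpret module s by fact
  show ?thesis
    unfolding lin_ext_def using assms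
    by (intro sum.mono_neutral_left) (auto simp: not_in_keys_iff_lookup_eq_zero)
qed

lemma linear_lin_ext:
  fixes s :: "'k::field \<Rightarrow> 'v::ab_group_add \<Rightarrow> 'v" and f :: "'x \<Rightarrow> 'v"
  assumes "vector_space s"
  shows "Vector_Spaces.linear fscale s (lin_ext s f)"
proof -
  interpret vector_space s by fact
  have m: "module s" ..
  show ?thesis
    unfolding Vector_Spaces.linear_iff
  proof (intro conjI allI assms fs.vector_space_axioms)
    fix p q :: "'x \<Rightarrow>\<^sub>0 'k"
    show "lin_ext s f (p + q) = lin_ext s f p + lin_ext s f q"
      using keys_add[of p q]
      by (simp add: lin_ext_superset[OF m, of "Poly_Mapping.keys p \<union> Poly_Mapping.keys q"] lookup_add
          scale_left_distrib sum.distrib)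
  next
    fix c and p :: "'x \<Rightarrow>\<^sub>0 'k"
    have "Poly_Mapping.keys (fscale c p) \<subseteq> Poly_Mapping.keys p" by (auto simp: in_keys_iff)
    then show "lin_ext s f (fscale c p) = s c (lin_ext s f p)"
      by (simp add: lin_ext_superset[OF m, of "Poly_Mapping.keys p"] scale_sum_right)
  qed
qed

lemma lin_ext_single:
  assumes "vector_space s"
  shows "lin_ext s f (Poly_Mapping.single x c) = s c (f x)"
proof -
  interpret vector_space s by fact
  have m: "module s" ..
  show ?thesis by (subst lin_ext_superset[OF m, of "{x}"]) auto
qed

lemma linear_eq_sum:
  assumes "Vector_Spaces.linear fscale s f"
  shows "f p = (\<Sum>x\<in>Poly_Mapping.keys p. s (Poly_Mapping.lookup p x) (f (Poly_Mapping.single x 1)))"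
proof -
  interpret f: Vector_Spaces.linear fscale s f by fact
  have "f p = f (\<Sum>x\<in>Poly_Mapping.keys p. fscale (Poly_Mapping.lookup p x) (Poly_Mapping.single x 1))"
    using poly_mapping_eq_sum[of p] by simp
  then show ?thesis by (simp only: f.sum f.scale)
qed

text \<open>Only tensors in the support of p are tested, so a chain of fixed degree is checked on
  lists of one length.\<close>

lemma linear_eq_on_keys:
  assumes "Vector_Spaces.linear fscale s f" "Vector_Spaces.linear fscale s g"
    and "\<And>x. x \<in> Poly_Mapping.keys p \<Longrightarrow> f (Poly_Mapping.single x 1) = g (Poly_Mapping.single x 1)"
  shows "f p = g p"
  unfolding linear_eq_sum[OF assms(1), of p] linear_eq_sum[OF assms(2), of p]
  by (simp add: assms(3))

lemma linear_mem_on_keys: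
  assumes "Vector_Spaces.linear fscale s f" "module.subspace s V"
    and "\<And>x. x \<in> Poly_Mapping.keys p \<Longrightarrow> f (Poly_Mapping.single x 1) \<in> V"
  shows "f p \<in> V"
proof -
  interpret f: Vector_Spaces.linear fscale s f by fact
  show ?thesis
    unfolding linear_eq_sum[OF assms(1), of p] using assms(2,3)
    by (intro f.vs2.subspace_sum f.vs2.subspace_scale)
qed

section \<open>The negative cyclic cycle\<close>

definition alternating :: "'a \<Rightarrow> 'a \<Rightarrow> nat \<Rightarrow> 'a list" where
  "alternating u v n = concat (replicate n [u, v])"

lemma length_alternating [simp]: "length (alternating u v n) = 2 * n"
  by (induction n) (auto simp: alternating_def)

lemma alternating_Suc: "alternating u v (Suc n) = u # v # alternating u v n"
  by (simp add: alternating_def)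

lemma alternating_0 [simp]: "alternating u v 0 = []"
  by (simp add: alternating_def)

lemma alternating_snoc: "alternating u v n @ [u] = u # alternating v u n"
  by (induction n) (simp_all add: alternating_Suc)

text \<open>Peels off both ends at once, as the cyclic face of \<open>hh_b\<close> requires.\<close>

lemma alternating_Suc': "alternating u v (Suc n) = u # alternating v u n @ [v]"
  by (induction n) (simp_all add: alternating_Suc)

lemma nth_alternating: "i < 2 * n \<Longrightarrow> alternating u v n ! i = (if even i then u else v)"
  by (induction n arbitrary: i u v) (auto simp: alternating_Suc nth_Cons split: nat.splits)

lemma rotate_alternating: "rotate i (alternating u v n) = (if even i then alternating u v n else alternating v u n)"
proof (induction i)
  case (Suc i)
  have "rotate1 (alternating u v n) = alternating v u n" for u v :: 'a
    by (cases n) (simp_all add: alternating_Suc alternating_snoc)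
  with Suc show ?case by simp
qed simp

context k_algebra
begin

lemma linear_hh_b: "Vector_Spaces.linear fscale fscale hh_b"
  unfolding hh_b_def by (rule linear_lin_ext) unfold_locales

lemma linear_connes_B: "Vector_Spaces.linear fscale fscale connes_B"
  unfolding connes_B_def by (rule linear_lin_ext) unfold_locales

sublocale hh_b: Vector_Spaces.linear fscale fscale hh_b
  by (rule linear_hh_b)

sublocale connes_B: Vector_Spaces.linear fscale fscale connes_B
  by (rule linear_connes_B)

lemma hh_b_single:
  "hh_b (Poly_Mapping.single as 1) =
     (let n = length as - 1 in
     if n = 0 then 0
     else (\<Sum>i<n. signed i (Poly_Mapping.single (merge_adjacent i as) 1))
          + signed n (Poly_Mapping.single ((last as * hd as) # butlast (tl as)) 1))"
  unfolding hh_b_def by (subst lin_ext_single) (unfold_locales, simp)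

lemma connes_B_single:
  "connes_B (Poly_Mapping.single as 1) =
     (let n = length as - 1 in
     \<Sum>i\<le>n. signed (n * i) (Poly_Mapping.single (1 # drop i as @ take i as) 1))"
  unfolding connes_B_def by (subst lin_ext_single) (unfold_locales, simp)

lemma subspace_hh_null: "fs.subspace hh_null"
  by (simp add: hh_null_def)

lemma hh_null_relator_add:
  assumes "i < length as"
  shows "Poly_Mapping.single (as[i := a + a']) 1
        - Poly_Mapping.single (as[i := a]) 1 - Poly_Mapping.single (as[i := a']) 1 \<in> hh_null"
  unfolding hh_null_def hh_relators_def using assms by (intro fs.span_base) blast

lemma hh_null_relator_scale:
  assumes "i < length as"
  shows "Poly_Mapping.single (as[i := c *s a]) 1 - Poly_Mapping.single (as[i := a]) c \<in> hh_null"
  unfolding hh_null_def hh_relators_def using assms by (intro fs.span_base) blast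

lemma hh_null_relator_unit:
  assumes "i < length as" "0 < i"
  shows "Poly_Mapping.single (as[i := c *s 1]) 1 \<in> hh_null"
  unfolding hh_null_def hh_relators_def using assms by (intro fs.span_base) blast

lemma hh_null_unit:
  assumes "i < length as" "0 < i" "as ! i = 1"
  shows "Poly_Mapping.single as 1 \<in> hh_null"
  using hh_null_relator_unit[OF assms(1,2), of 1] assms(3) by (metis list_update_id scale_one)

lemma signed_hh_null: "p \<in> hh_null \<Longrightarrow> signed i p \<in> hh_null"
  by (simp add: signed_def fs.subspace_neg subspace_hh_null)

text \<open>The two faces that survive put the unit into slot 0, which is not reduced: the face
  merging the first two entries, and the cyclic face, whose sign is -1 because the degree 2m+1 is
  odd and which leaves the rotated tensor.\<close>

lemma hh_b_alternating:
  assumes uv: "u * v = 1" "v * u = 1"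
  shows "hh_b (Poly_Mapping.single (alternating u v (Suc m)) 1)
     - (Poly_Mapping.single (1 # alternating u v m) 1 - Poly_Mapping.single (1 # alternating v u m) 1)
     \<in> hh_null"
proof -
  let ?as = "alternating u v (Suc m)"
  let ?t = "\<lambda>i. signed i (Poly_Mapping.single (merge_adjacent i ?as) (1::'k))"
  have "?t (Suc i) \<in> hh_null" if "i < 2 * m" for i
  proof (intro signed_hh_null hh_null_unit)
    show "merge_adjacent (Suc i) ?as ! (Suc i) = 1"
      using that uv by (simp add: merge_adjacent_def nth_append nth_alternating)
    show "Suc i < length (merge_adjacent (Suc i) ?as)"
      using that by (simp add: merge_adjacent_def)
  qed simp
  then have "(\<Sum>i<2*m. ?t (Suc i)) \<in> hh_null"
    by (intro fs.subspace_sum subspace_hh_null) auto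
  moreover have "hh_b (Poly_Mapping.single ?as 1) = Poly_Mapping.single (1 # alternating u v m) 1
      + (\<Sum>i<2*m. ?t (Suc i)) - Poly_Mapping.single (1 # alternating v u m) 1"
  proof -
    have "?t 0 = Poly_Mapping.single (1 # alternating u v m) 1"
      using uv by (simp add: signed_def merge_adjacent_def alternating_Suc)
    moreover have "last ?as * hd ?as = 1" "butlast (tl ?as) = alternating v u m"
      using uv by (simp_all add: alternating_Suc')
    ultimately show ?thesis
      by (simp add: hh_b_single Let_def sum.lessThan_Suc_shift signed_def del: sum.lessThan_Suc)
  qed
  ultimately show ?thesis by simp
qed

lemma sum_alternating_signs:
  "(\<Sum>i<2*m. signed i (if even i then p else q)) = fscale (of_nat m) (p - q)"
  by (induction m) (simp_all add: signed_def algebra_simps)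

text \<open>The 2m rotations give each of the two alternating tensors m times, with opposite signs.
  The case m = 0 has to be excluded: on the empty list the truncated subtraction in
  \<open>connes_B\<close> leaves one summand, the tensor \<open>[1]\<close>.\<close>

lemma connes_B_alternating:
  assumes "m > 0"
  shows "connes_B (Poly_Mapping.single (alternating u v m) 1) =
     fscale (of_nat m) (Poly_Mapping.single (1 # alternating u v m) 1
       - Poly_Mapping.single (1 # alternating v u m) 1)"
proof -
  have *: "drop i (alternating u v m) @ take i (alternating u v m)
      = (if even i then alternating u v m else alternating v u m)" if "i < 2 * m" for i
    using that rotate_drop_take[of i "alternating u v m"] by (simp add: rotate_alternating)
  have "connes_B (Poly_Mapping.single (alternating u v m) 1) = (\<Sum>i<2*m. signed ((2*m-1) * i)
      (Poly_Mapping.single (1 # drop i (alternating u v m) @ take i (alternating u v m)) 1))"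
    using assms lessThan_Suc_atMost[of "2*m-1"] by (simp add: connes_B_single Let_def)
  also have "\<dots> = (\<Sum>i<2*m. signed i (if even i then Poly_Mapping.single (1 # alternating u v m) 1
      else Poly_Mapping.single (1 # alternating v u m) 1))"
    \<comment> \<open>The degree 2m-1 is odd, so (2m-1) i has the parity of i.\<close>
    using assms by (intro sum.cong) (auto simp: * signed_def)
  finally show ?thesis by (simp add: sum_alternating_signs)
qed

end

section \<open>The first Hochschild homology of a commutative algebra\<close>

lemma lookup_map_mult [simp]:
  "Poly_Mapping.lookup (Poly_Mapping.map ((*) a) p) x = (a :: 'a::mult_zero) * Poly_Mapping.lookup p x"
  by (simp add: map.rep_eq when_def)

interpretation kahler_module:
  module "\<lambda>a. Poly_Mapping.map ((*) a) :: ('x \<Rightarrow>\<^sub>0 'a::comm_ring_1) \<Rightarrow> 'x \<Rightarrow>\<^sub>0 'a"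
  by standard (auto intro!: poly_mapping_eqI simp: lookup_add algebra_simps)

context k_algebra
begin

lemma subspace_hh_chains: "fs.subspace (hh_chains n)"
proof (rule fs.subspaceI)
  fix p q :: "'a list \<Rightarrow>\<^sub>0 'k" assume "p \<in> hh_chains n" "q \<in> hh_chains n"
  then show "p + q \<in> hh_chains n"
    using keys_add[of p q] by (auto simp: hh_chains_def)
qed (auto simp: hh_chains_def in_keys_iff)

text \<open>This is \<open>hh_boundaries\<close> without the degree condition on p. As
  \<open>hh_null\<close> contains tensors of every length, only this larger space contains all of
  it.\<close>

lemma subspace_boundary_condition:
  "fs.subspace {p. \<exists>q\<in>hh_chains n. p - hh_b q \<in> hh_null}" (is "fs.subspace ?S")
proof (rule fs.subspaceI)
  show "0 \<in> ?S"
    using fs.subspace_0[OF subspace_hh_chains] fs.subspace_0[OF subspace_hh_null]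
    by (auto intro: bexI[of _ 0])
next
  fix x y assume "x \<in> ?S" "y \<in> ?S"
  then obtain q r where "q \<in> hh_chains n" "x - hh_b q \<in> hh_null" "r \<in> hh_chains n" "y - hh_b r \<in> hh_null"
    by blast
  then show "x + y \<in> ?S"
    using fs.subspace_add[OF subspace_hh_chains, of q n r]
      fs.subspace_add[OF subspace_hh_null, of "x - hh_b q" "y - hh_b r"]
    by (auto intro!: bexI[of _ "q + r"] simp: hh_b.add algebra_simps)
next
  fix c x assume "x \<in> ?S"
  then obtain q where "q \<in> hh_chains n" "x - hh_b q \<in> hh_null"
    by blast
  then show "fscale c x \<in> ?S"
    using fs.subspace_scale[OF subspace_hh_chains, of q n c]
      fs.subspace_scale[OF subspace_hh_null, of "x - hh_b q" c]
    by (auto intro!: bexI[of _ "fscale c q"] simp: hh_b.scale fs.scale_right_diff_distrib)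
qed

lemma hh_null_subset_boundary:
  "p \<in> hh_null \<Longrightarrow> p \<in> {p. \<exists>q\<in>hh_chains n. p - hh_b q \<in> hh_null}"
  using fs.subspace_0[OF subspace_hh_chains] by (auto intro!: bexI[of _ 0])

end

context comm_k_algebra
begin

abbreviation (input) "dscale \<equiv> \<lambda>a. Poly_Mapping.map ((*) a)"

text \<open>Restriction of scalars from A to k, so that \<open>hkr1\<close> fits the
  linear-extension lemmas, which work over k.\<close>

lemma vector_space_kahler: "vector_space (\<lambda>c. dscale (c *s (1 :: 'a)) :: ('a \<Rightarrow>\<^sub>0 'a) \<Rightarrow> _)"
  by standard (auto simp: kahler_module.scale_right_distrib
      kahler_module.scale_left_distrib scale_left_distrib scale_mult_left)

lemma subspace_kahler_null: "kahler_module.subspace kahler_null"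
  by (simp add: kahler_null_def)

lemma subspace_kahler_null': "module.subspace (\<lambda>c. dscale (c *s 1)) kahler_null"
proof -
  interpret v: vector_space "\<lambda>c. dscale (c *s (1 :: 'a)) :: ('a \<Rightarrow>\<^sub>0 'a) \<Rightarrow> _"
    by (rule vector_space_kahler)
  show ?thesis
    using subspace_kahler_null
    by (simp add: v.subspace_def kahler_module.subspace_def)
qed

lemma dscale_single [simp]:
  "dscale a (Poly_Mapping.single b c) = Poly_Mapping.single b (a * c :: 'a)"
  by (auto intro!: poly_mapping_eqI simp: lookup_single when_def)

lemma kahler_null_add:
  "Poly_Mapping.single (a + b) c - Poly_Mapping.single a c - Poly_Mapping.single b c \<in> kahler_null"
proof -
  have "Poly_Mapping.single (a + b) 1 - Poly_Mapping.single a 1 - Poly_Mapping.single b 1 \<in> kahler_null"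
    unfolding kahler_null_def by (rule kahler_module.span_base) blast
  from kahler_module.subspace_scale[OF subspace_kahler_null this, of c] show ?thesis
    by (simp add: kahler_module.scale_right_diff_distrib)
qed

lemma kahler_null_mult:
  "Poly_Mapping.single (a * b) c - Poly_Mapping.single b (c * a) - Poly_Mapping.single a (c * b) \<in> kahler_null"
proof -
  have "Poly_Mapping.single (a * b) 1 - Poly_Mapping.single b a - Poly_Mapping.single a b \<in> kahler_null"
    unfolding kahler_null_def by (rule kahler_module.span_base) blast
  from kahler_module.subspace_scale[OF subspace_kahler_null this, of c] show ?thesis
    by (simp add: kahler_module.scale_right_diff_distrib)
qed

lemma kahler_null_unit: "Poly_Mapping.single (c *s 1) a \<in> kahler_null"
proof -
  have "Poly_Mapping.single (c *s 1) 1 \<in> kahler_null"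
    unfolding kahler_null_def by (rule kahler_module.span_base) blast
  from kahler_module.subspace_scale[OF subspace_kahler_null this, of a] show ?thesis by simp
qed

text \<open>Homogeneity of d over k is not among the defining relations; it follows from the Leibniz
  rule for the product of \<open>c *s 1\<close> and b together with d(c 1) = 0.\<close>

lemma kahler_null_scale:
  "Poly_Mapping.single (c *s b) a - Poly_Mapping.single b (c *s a) \<in> kahler_null"
proof -
  have "Poly_Mapping.single (c *s b) a - Poly_Mapping.single b (a * (c *s 1))
      - Poly_Mapping.single (c *s 1) (a * b) \<in> kahler_null"
    using kahler_null_mult[of "c *s 1" b a] by (simp add: scale_mult_left)
  from kahler_module.subspace_add[OF subspace_kahler_null this kahler_null_unit[of c "a * b"]]
  show ?thesis by (simp add: scale_mult_right)
qed

lemma hkr1_eq_lin_ext: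
  "hkr1 = lin_ext (\<lambda>c. dscale (c *s 1)) (\<lambda>as. Poly_Mapping.single (as ! 1) (as ! 0))"
  by (rule ext) (simp add: hkr1_def lin_ext_def scale_mult_left)

lemma linear_hkr1: "Vector_Spaces.linear fscale (\<lambda>c. dscale (c *s 1)) hkr1"
  unfolding hkr1_eq_lin_ext by (rule linear_lin_ext) (rule vector_space_kahler)

sublocale hkr1: Vector_Spaces.linear fscale "\<lambda>c. dscale (c *s 1)" hkr1
  by (rule linear_hkr1)

lemma hkr1_single: "hkr1 (Poly_Mapping.single as c) = Poly_Mapping.single (as ! 1) (c *s (as ! 0))"
  unfolding hkr1_eq_lin_ext by (subst lin_ext_single[OF vector_space_kahler]) (simp add: scale_mult_left)

(* hkr1 reads two entries of a tensor of any length, so it respects hh_null only after this projection. *)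
definition degree1_part :: "('a list \<Rightarrow>\<^sub>0 'k) \<Rightarrow> ('a list \<Rightarrow>\<^sub>0 'k)" where
  "degree1_part = lin_ext fscale (\<lambda>as. if length as = 2 then Poly_Mapping.single as 1 else 0)"

lemma linear_degree1_part: "Vector_Spaces.linear fscale fscale degree1_part"
  unfolding degree1_part_def by (rule linear_lin_ext) unfold_locales

sublocale degree1_part: Vector_Spaces.linear fscale fscale degree1_part
  by (rule linear_degree1_part)

lemma degree1_part_single:
  "degree1_part (Poly_Mapping.single as c) = (if length as = 2 then Poly_Mapping.single as c else 0)"
  unfolding degree1_part_def by (subst lin_ext_single) (unfold_locales, simp)

lemma degree1_part_id:
  assumes "p \<in> hh_chains 1"
  shows "degree1_part p = p"
proof -
  have "Vector_Spaces.linear fscale fscale (\<lambda>p :: 'a list \<Rightarrow>\<^sub>0 'k. p)"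
    by (rule fs.linear_ident)
  from linear_eq_on_keys[OF linear_degree1_part this] assms show ?thesis
    by (simp add: hh_chains_def degree1_part_single)
qed

text \<open>Checked on relators: in slot 0 they map to zero or to a trivial relation of
  coefficients, in slot 1 to additivity, homogeneity and vanishing on constants of d, and those on
  lists of length other than 2 are removed by the projection.\<close>

lemma hkr1_degree1_null:
  assumes "p \<in> hh_null"
  shows "hkr1 (degree1_part p) \<in> kahler_null"
proof -
  note sub = kahler_module.subspace_add[OF subspace_kahler_null]
    kahler_module.subspace_0[OF subspace_kahler_null]
  have rel: "hkr1 (degree1_part r) \<in> kahler_null" if "r \<in> hh_relators" for r
    using that unfolding hh_relators_def
  proof (elim UnE CollectE exE conjE)
    fix as :: "'a list" and i a a'
    assume "i < length as" "r = Poly_Mapping.single (as[i := a + a']) 1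
        - Poly_Mapping.single (as[i := a]) 1 - Poly_Mapping.single (as[i := a']) 1"
    then show ?thesis
      by (cases i; cases "i = 1")
        (auto simp: degree1_part.diff degree1_part_single hkr1.diff hkr1_single sub
          single_add kahler_null_add nth_list_update)
  next
    fix as :: "'a list" and i c a
    assume "i < length as"
      "r = Poly_Mapping.single (as[i := c *s a]) 1 - Poly_Mapping.single (as[i := a]) c"
    then show ?thesis
      by (cases i; cases "i = 1")
        (auto simp: degree1_part.diff degree1_part_single hkr1.diff hkr1_single sub
          kahler_null_scale nth_list_update)
  next
    fix as :: "'a list" and i c
    assume "0 < i" "i < length as" "r = Poly_Mapping.single (as[i := c *s 1]) 1"
    then show ?thesis
      by (cases "i = 1") (auto simp: degree1_part_single hkr1_single sub
          kahler_null_unit nth_list_update)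
  qed
  have "fs.subspace {p. hkr1 (degree1_part p) \<in> kahler_null}"
    using subspace_kahler_null hkr1.vs2.subspace_scale[OF subspace_kahler_null']
    by (auto simp: fs.subspace_def kahler_module.subspace_def degree1_part.add hkr1.add
        degree1_part.scale hkr1.scale)
  then have "hh_null \<subseteq> {p. hkr1 (degree1_part p) \<in> kahler_null}"
    unfolding hh_null_def using rel by (intro fs.span_minimal) auto
  with assms show ?thesis by auto
qed

text \<open>The three faces of a \<otimes> b \<otimes> c give ab dc - a d(bc) + ca db, the negative
  of a Leibniz relation. The projection changes nothing on these faces; it is there so that this
  fact can be added to \<open>hkr1_degree1_null\<close>.\<close>

lemma hkr1_hh_b:
  assumes "q \<in> hh_chains 2"
  shows "hkr1 (degree1_part (hh_b q)) \<in> kahler_null"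
proof (rule linear_mem_on_keys[OF _ subspace_kahler_null', where p = q and f = "\<lambda>q. hkr1 (degree1_part (hh_b q))"])
  show "Vector_Spaces.linear fscale (\<lambda>c. dscale (c *s 1)) (\<lambda>q. hkr1 (degree1_part (hh_b q)))"
    using Vector_Spaces.linear_compose[OF Vector_Spaces.linear_compose[OF linear_hh_b linear_degree1_part] linear_hkr1]
    by (simp add: o_def)
next
  fix as assume "as \<in> Poly_Mapping.keys q"
  with assms have "length as = 3" by (auto simp: hh_chains_def)
  then obtain a b c where as: "as = [a, b, c]"
    by (auto simp: numeral_3_eq_3 length_Suc_conv)
  have "hkr1 (degree1_part (hh_b (Poly_Mapping.single as 1)))
      = - (Poly_Mapping.single (b * c) a - Poly_Mapping.single c (a * b) - Poly_Mapping.single b (a * c))"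
    by (simp add: as hh_b_single merge_adjacent_def signed_def numeral_2_eq_2
        degree1_part.add degree1_part.neg degree1_part.diff degree1_part_single
        hkr1.add hkr1.diff hkr1.neg hkr1_single mult.commute)
  then show "hkr1 (degree1_part (hh_b (Poly_Mapping.single as 1))) \<in> kahler_null"
    using kahler_module.subspace_neg[OF subspace_kahler_null kahler_null_mult] by simp
qed

text \<open>A section of \<open>hkr1\<close>. It is an honest function on representatives, but a
  coefficient in A becomes a tensor entry, so additivity holds only modulo
  \<open>hh_null\<close>.\<close>

definition kahler_to_chain :: "('a \<Rightarrow>\<^sub>0 'a) \<Rightarrow> ('a list \<Rightarrow>\<^sub>0 'k)" where
  "kahler_to_chain w = (\<Sum>b\<in>Poly_Mapping.keys w. Poly_Mapping.single [Poly_Mapping.lookup w b, b] 1)"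

lemma kahler_to_chain_chains: "kahler_to_chain w \<in> hh_chains 1"
  unfolding kahler_to_chain_def
  by (intro fs.subspace_sum subspace_hh_chains) (auto simp: hh_chains_def)

lemma hkr1_kahler_to_chain: "hkr1 (kahler_to_chain w) = w"
  using poly_mapping_eq_sum[of w] by (simp add: kahler_to_chain_def hkr1.sum hkr1_single)

lemma hh_null_zero: "Poly_Mapping.single [0, b] 1 \<in> hh_null"
  using hh_null_relator_scale[of 0 "[0, b]" 0 0] by simp

lemma kahler_to_chain_superset:
  assumes "finite K" "Poly_Mapping.keys w \<subseteq> K"
  shows "(\<Sum>b\<in>K. Poly_Mapping.single [Poly_Mapping.lookup w b, b] 1) - kahler_to_chain w \<in> hh_null"
proof -
  have "(\<Sum>b\<in>K. Poly_Mapping.single [Poly_Mapping.lookup w b, b] 1) - kahler_to_chain w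
      = (\<Sum>b\<in>K - Poly_Mapping.keys w. Poly_Mapping.single [Poly_Mapping.lookup w b, b] (1 :: 'k))"
    using assms by (simp add: kahler_to_chain_def sum_diff)
  also have "\<dots> \<in> hh_null"
    by (intro fs.subspace_sum subspace_hh_null) (auto simp: in_keys_iff hh_null_zero)
  finally show ?thesis .
qed

lemma kahler_to_chain_single:
  "kahler_to_chain (Poly_Mapping.single b a) - Poly_Mapping.single [a, b] 1 \<in> hh_null"
  using fs.subspace_neg[OF subspace_hh_null kahler_to_chain_superset[of "{b}" "Poly_Mapping.single b a"]]
  by simp

lemma kahler_to_chain_add:
  "kahler_to_chain (v + w) - (kahler_to_chain v + kahler_to_chain w) \<in> hh_null"
proof -
  let ?K = "Poly_Mapping.keys v \<union> Poly_Mapping.keys w"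
  let ?s = "\<lambda>w. \<Sum>b\<in>?K. Poly_Mapping.single [Poly_Mapping.lookup w b, b] (1 :: 'k)"
  have "Poly_Mapping.single [x + y, b] 1 - Poly_Mapping.single [x, b] 1 - Poly_Mapping.single [y, b] 1
      \<in> hh_null" for x y b
    using hh_null_relator_add[of 0 "[0, b]" x y] by simp
  then have "(\<Sum>b\<in>?K. Poly_Mapping.single [Poly_Mapping.lookup v b + Poly_Mapping.lookup w b, b] 1
      - Poly_Mapping.single [Poly_Mapping.lookup v b, b] 1
      - Poly_Mapping.single [Poly_Mapping.lookup w b, b] 1) \<in> hh_null"
    by (intro fs.subspace_sum subspace_hh_null)
  then have 1: "?s (v + w) - ?s v - ?s w \<in> hh_null"
    by (simp add: sum_subtractf lookup_add)
  have 2: "?s v - kahler_to_chain v \<in> hh_null" "?s w - kahler_to_chain w \<in> hh_null"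
    "?s (v + w) - kahler_to_chain (v + w) \<in> hh_null"
    using keys_add[of v w] by (auto intro!: kahler_to_chain_superset)
  have "kahler_to_chain (v + w) - (kahler_to_chain v + kahler_to_chain w)
      = (?s (v + w) - ?s v - ?s w) - (?s (v + w) - kahler_to_chain (v + w))
       + (?s v - kahler_to_chain v) + (?s w - kahler_to_chain w)"
    by simp
  also have "\<dots> \<in> hh_null"
    by (intro fs.subspace_add fs.subspace_diff subspace_hh_null 1 2)
  finally show ?thesis .
qed

lemma kahler_to_chain_diff:
  "kahler_to_chain (v - w) - (kahler_to_chain v - kahler_to_chain w) \<in> hh_null"
  using fs.subspace_neg[OF subspace_hh_null kahler_to_chain_add[of "v - w" w]]
  by (simp add: algebra_simps)

lemma kahler_to_chain_hkr1:
  "kahler_to_chain (hkr1 (degree1_part p)) - degree1_part p \<in> hh_null"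
proof (induction p rule: poly_mapping_single_induct)
  case zero
  then show ?case
    using fs.subspace_0[OF subspace_hh_null] by (simp add: degree1_part.zero hkr1.zero kahler_to_chain_def)
next
  case (single as c)
  show ?case
  proof (cases "length as = 2")
    case True
    then obtain a b where as: "as = [a, b]"
      by (auto simp: numeral_2_eq_2 length_Suc_conv)
    have "Poly_Mapping.single [c *s a, b] 1 - Poly_Mapping.single [a, b] c \<in> hh_null"
      using hh_null_relator_scale[of 0 "[0, b]" c a] by simp
    from fs.subspace_add[OF subspace_hh_null kahler_to_chain_single[of b "c *s a"] this]
    show ?thesis by (simp add: as degree1_part_single hkr1_single)
  next
    case False
    then show ?thesis
      using fs.subspace_0[OF subspace_hh_null]
      by (simp add: degree1_part_single hkr1.zero kahler_to_chain_def)
  qed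
next
  case (add p q)
  have "kahler_to_chain (hkr1 (degree1_part (p + q))) - degree1_part (p + q)
    = (kahler_to_chain (hkr1 (degree1_part p) + hkr1 (degree1_part q))
        - (kahler_to_chain (hkr1 (degree1_part p)) + kahler_to_chain (hkr1 (degree1_part q))))
      + (kahler_to_chain (hkr1 (degree1_part p)) - degree1_part p)
      + (kahler_to_chain (hkr1 (degree1_part q)) - degree1_part q)"
    by (simp add: degree1_part.add hkr1.add)
  also have "\<dots> \<in> hh_null"
    by (intro fs.subspace_add subspace_hh_null kahler_to_chain_add add)
  finally show ?case .
qed

lemma kahler_to_chain_null:
  assumes "w \<in> kahler_null"
  shows "kahler_to_chain w \<in> {p. \<exists>q\<in>hh_chains 2. p - hh_b q \<in> hh_null}" (is "_ \<in> ?Bd")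
proof -
  note Bd = subspace_boundary_condition[of 2]
  let ?k = kahler_to_chain
  have null: "p \<in> ?Bd" if "p \<in> hh_null" for p using that by (rule hh_null_subset_boundary)
  have cong: "p \<in> ?Bd" if "p - q \<in> hh_null" "q \<in> ?Bd" for p q
    using fs.subspace_add[OF Bd null[OF that(1)] that(2)] by simp
  have diff: "?k (u - v - w) - (Poly_Mapping.single [a, b] 1 - Poly_Mapping.single [a', b'] 1
      - Poly_Mapping.single [a'', b''] 1) \<in> hh_null"
    if "u = Poly_Mapping.single b a" "v = Poly_Mapping.single b' a'" "w = Poly_Mapping.single b'' a''"
    for u v w a a' a'' b b' b''
  proof -
    have "?k (u - v - w) - (Poly_Mapping.single [a, b] 1 - Poly_Mapping.single [a', b'] 1
        - Poly_Mapping.single [a'', b''] 1)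
      = (?k (u - v - w) - (?k (u - v) - ?k w)) + (?k (u - v) - (?k u - ?k v))
       + (?k u - Poly_Mapping.single [a, b] 1) - (?k v - Poly_Mapping.single [a', b'] 1)
       - (?k w - Poly_Mapping.single [a'', b''] 1)"
      by simp
    also have "\<dots> \<in> hh_null"
      unfolding that
      by (intro fs.subspace_add fs.subspace_diff subspace_hh_null kahler_to_chain_diff kahler_to_chain_single)
    finally show ?thesis .
  qed
  \<comment> \<open>Only additivity modulo null elements is available for
    \<open>kahler_to_chain\<close>, not A-linearity, so the induction adds one multiple
    \<open>dscale c x\<close> of a relator at a time.\<close>
  show ?thesis
    using assms unfolding kahler_null_def
  proof (induction rule: kahler_module.span_induct_alt)
    case base
    then show ?case using fs.subspace_0[OF Bd] by (simp add: kahler_to_chain_def)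
  next
    case (step c x y)
    from step(1) have "?k (dscale c x) \<in> ?Bd"
    proof (elim UnE CollectE exE conjE)
      fix a b assume "x = Poly_Mapping.single (a + b) 1 - Poly_Mapping.single a 1 - Poly_Mapping.single b 1"
      then have eq: "dscale c x = Poly_Mapping.single (a + b) c - Poly_Mapping.single a c - Poly_Mapping.single b c"
        by (simp add: kahler_module.scale_right_diff_distrib)
      have mem: "Poly_Mapping.single [c, a + b] 1 - Poly_Mapping.single [c, a] 1
          - Poly_Mapping.single [c, b] 1 \<in> ?Bd"
        using null[OF hh_null_relator_add[of 1 "[c, 0]" a b]] by simp
      show ?thesis unfolding eq by (rule cong[OF diff[OF refl refl refl] mem])
    next
      fix a b assume "x = Poly_Mapping.single (a * b) 1 - Poly_Mapping.single b a - Poly_Mapping.single a b"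
      then have eq: "dscale c x = Poly_Mapping.single (a * b) c - Poly_Mapping.single b (c * a)
          - Poly_Mapping.single a (c * b)"
        by (simp add: kahler_module.scale_right_diff_distrib)
      have mem: "Poly_Mapping.single [c, a * b] 1 - Poly_Mapping.single [c * a, b] 1
          - Poly_Mapping.single [c * b, a] 1 \<in> ?Bd"
      proof -
        have "hh_b (- Poly_Mapping.single [c, a, b] 1) = Poly_Mapping.single [c, a * b] 1
            - Poly_Mapping.single [c * a, b] 1 - Poly_Mapping.single [c * b, a] 1"
          by (simp add: hh_b.neg hh_b_single merge_adjacent_def signed_def numeral_2_eq_2 mult.commute)
        moreover have "- Poly_Mapping.single [c, a, b] 1 \<in> hh_chains 2"
          by (simp add: hh_chains_def keys_minus)
        ultimately show ?thesis
          using fs.subspace_0[OF subspace_hh_null]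
          by (auto intro!: bexI[of _ "- Poly_Mapping.single [c, a, b] 1"])
      qed
      show ?thesis unfolding eq by (rule cong[OF diff[OF refl refl refl] mem])
    next
      fix d assume "x = Poly_Mapping.single (d *s 1) 1"
      then have eq: "dscale c x = Poly_Mapping.single (d *s 1) c" by simp
      have mem: "Poly_Mapping.single [c, d *s 1] 1 \<in> ?Bd"
        using null[OF hh_null_relator_unit[of 1 "[c, 0]" d]] by simp
      show ?thesis unfolding eq by (rule cong[OF kahler_to_chain_single mem])
    qed
    from cong[OF kahler_to_chain_add fs.subspace_add[OF Bd this step(2)]] show ?case .
  qed
qed

text \<open>Commutativity: the two faces of a \<otimes> b are ab and ba, with opposite
  signs.\<close>

lemma hh_cycles_1: "hh_cycles 1 = hh_chains 1"
proof -
  have "hh_b p \<in> {0}" if "p \<in> hh_chains 1" for p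
  proof (rule linear_mem_on_keys[OF linear_hh_b fs.subspace_single_0])
    fix as assume "as \<in> Poly_Mapping.keys p"
    with that have "length as = 2" by (auto simp: hh_chains_def)
    then obtain a b where "as = [a, b]"
      by (auto simp: numeral_2_eq_2 length_Suc_conv)
    then show "hh_b (Poly_Mapping.single as 1) \<in> {0}"
      by (simp add: hh_b_single merge_adjacent_def signed_def mult.commute)
  qed
  then show ?thesis
    using fs.subspace_0[OF subspace_hh_null] by (auto simp: hh_cycles_def)
qed

text \<open>For injectivity, w differs from \<open>kahler_to_chain (hkr1 w)\<close> by a null
  element, and the latter is a boundary once \<open>hkr1 w\<close> is null. Surjectivity holds
  exactly, not just modulo relations, since \<open>kahler_to_chain\<close> is a section.\<close>

theorem hkr1_iso: "induces_bij hkr1 (hh_cycles 1) (hh_boundaries 1) UNIV kahler_null"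
  unfolding induces_bij_def hh_cycles_1
proof (intro conjI ballI)
  fix u u' assume u: "u \<in> hh_chains 1" "u' \<in> hh_chains 1"
  define w where "w = u - u'"
  have w: "w \<in> hh_chains 1" unfolding w_def by (intro fs.subspace_diff subspace_hh_chains u)
  have "w \<in> hh_boundaries 1 \<longleftrightarrow> hkr1 w \<in> kahler_null"
  proof
    assume "w \<in> hh_boundaries 1"
    then obtain q where q: "q \<in> hh_chains 2" "w - hh_b q \<in> hh_null"
      by (auto simp: hh_boundaries_def)
    from kahler_module.subspace_add[OF subspace_kahler_null hkr1_degree1_null[OF q(2)] hkr1_hh_b[OF q(1)]]
    show "hkr1 w \<in> kahler_null"
      using w by (simp add: degree1_part.diff hkr1.diff degree1_part_id)
  next
    assume "hkr1 w \<in> kahler_null"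
    from fs.subspace_diff[OF subspace_boundary_condition kahler_to_chain_null[OF this]
        hh_null_subset_boundary[OF kahler_to_chain_hkr1[of w]]]
    show "w \<in> hh_boundaries 1"
      using w by (simp add: hh_boundaries_def degree1_part_id)
  qed
  then show "u - u' \<in> hh_boundaries 1 \<longleftrightarrow> hkr1 u - hkr1 u' \<in> kahler_null"
    by (simp add: w_def hkr1.diff)
next
  fix v
  show "\<exists>u\<in>hh_chains 1. hkr1 u - v \<in> kahler_null"
    using kahler_to_chain_chains kahler_module.subspace_0[OF subspace_kahler_null]
    by (intro bexI[of _ "kahler_to_chain v"]) (simp_all add: hkr1_kahler_to_chain)
qed simp

end

section \<open>The enveloping algebra of the Laurent polynomials\<close>

(* A \<otimes> A is modelled by Laurent polynomials with coefficients in A: the left tensor factor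
   is the outer variable and the right one the coefficient ring. *)

lemma multiplicative_on_singles:
  fixes f :: "('i::monoid_add \<Rightarrow>\<^sub>0 'c::semiring_0) \<Rightarrow> 'r::ring"
  assumes add: "\<And>p q. f (p + q) = f p + f q"
    and single: "\<And>i c j d. f (Poly_Mapping.single i c * Poly_Mapping.single j d)
      = f (Poly_Mapping.single i c) * f (Poly_Mapping.single j d)"
  shows "f (p * q) = f p * f q"
proof -
  have zero: "f 0 = 0" using add[of 0 0] by simp
  have "f (Poly_Mapping.single i c * q) = f (Poly_Mapping.single i c) * f q" for i c
    by (induction q rule: poly_mapping_single_induct) (simp_all add: zero single add distrib_left)
  then show ?thesis
    by (induction p rule: poly_mapping_single_induct) (simp_all add: zero add distrib_right)
qed

definition const2 :: "'k::field \<Rightarrow> 'k laurent laurent" where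
  "const2 c = Poly_Mapping.single 0 (Poly_Mapping.single 0 c)"

lemma const2_add: "const2 (c + d) = const2 c + const2 d"
  and const2_mult: "const2 (c * d) = const2 c * const2 d"
  and const2_1 [simp]: "const2 1 = 1"
  by (simp_all add: const2_def single_add mult_single)

interpretation ring2: vector_space "\<lambda>c r. const2 c * r"
  by standard (simp_all add: const2_add const2_mult algebra_simps)

definition right_emb :: "'k::field laurent \<Rightarrow> 'k laurent laurent" where
  "right_emb b = Poly_Mapping.single 0 b"

definition left_emb :: "'k::field laurent \<Rightarrow> 'k laurent laurent" where
  "left_emb = lin_ext (\<lambda>c r. const2 c * r) (\<lambda>i. Poly_Mapping.single i 1)"

lemma right_emb_add: "right_emb (a + b) = right_emb a + right_emb b"
  and right_emb_mult: "right_emb (a * b) = right_emb a * right_emb b"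
  and right_emb_1 [simp]: "right_emb 1 = 1"
  and right_emb_fscale: "right_emb (fscale c a) = const2 c * right_emb a"
  by (simp_all add: right_emb_def const2_def fscale_eq_mult single_add mult_single)

interpretation left_emb: Vector_Spaces.linear fscale "\<lambda>c r. const2 c * r" left_emb
  unfolding left_emb_def by (rule linear_lin_ext) unfold_locales

lemma left_emb_single: "left_emb (Poly_Mapping.single i c) = Poly_Mapping.single i (Poly_Mapping.single 0 c)"
  unfolding left_emb_def
  by (subst lin_ext_single) (unfold_locales, simp add: const2_def mult_single)

lemma left_emb_mult: "left_emb (a * b) = left_emb a * left_emb b"
  by (rule multiplicative_on_singles) (simp_all add: left_emb.add left_emb_single mult_single)

lemma left_emb_1 [simp]: "left_emb 1 = 1"
  using left_emb_single[of 0 1] by simp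

lemma left_emb_const: "left_emb (fscale c 1) = const2 c"
  by (simp add: left_emb.scale)

text \<open>The multiplication map A \<otimes> A \<rightarrow> A in this model: the outer variable
  is specialised to x.\<close>

definition eval_diag :: "'k::field laurent laurent \<Rightarrow> 'k laurent" where
  "eval_diag r = (\<Sum>i\<in>Poly_Mapping.keys r. Poly_Mapping.single i 1 * Poly_Mapping.lookup r i)"

lemma eval_diag_superset:
  assumes "finite K" "Poly_Mapping.keys r \<subseteq> K"
  shows "eval_diag r = (\<Sum>i\<in>K. Poly_Mapping.single i 1 * Poly_Mapping.lookup r i)"
  unfolding eval_diag_def using assms
  by (intro sum.mono_neutral_left) (auto simp: in_keys_iff)

lemma eval_diag_add: "eval_diag (r + s) = eval_diag r + eval_diag s"
  using keys_add[of r s]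
  by (simp add: eval_diag_superset[of "Poly_Mapping.keys r \<union> Poly_Mapping.keys s"] lookup_add
      distrib_left sum.distrib)

lemma eval_diag_single: "eval_diag (Poly_Mapping.single i a) = Poly_Mapping.single i 1 * a"
  by (subst eval_diag_superset[of "{i}"]) auto

lemma eval_diag_mult: "eval_diag (r * s) = eval_diag r * eval_diag s"
proof (rule multiplicative_on_singles[where f = eval_diag, OF eval_diag_add])
  fix i j :: int and a b :: "'a laurent"
  have "Poly_Mapping.single (i + j) (1::'a) = Poly_Mapping.single i 1 * Poly_Mapping.single j 1"
    by (simp add: mult_single)
  then show "eval_diag (Poly_Mapping.single i a * Poly_Mapping.single j b)
      = eval_diag (Poly_Mapping.single i a) * eval_diag (Poly_Mapping.single j b)"
    by (simp add: mult_single eval_diag_single ac_simps)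
qed

lemma eval_diag_right_emb [simp]: "eval_diag (right_emb a) = a"
  by (simp add: right_emb_def eval_diag_single)

lemma eval_diag_const2 [simp]: "eval_diag (const2 c) = Poly_Mapping.single 0 c"
  by (simp add: const2_def eval_diag_single)

interpretation eval_diag: Vector_Spaces.linear "\<lambda>c r. const2 c * r" fscale eval_diag
  unfolding Vector_Spaces.linear_iff
  by (intro conjI ring2.vector_space_axioms fs.vector_space_axioms)
    (simp_all add: eval_diag_add eval_diag_mult fscale_eq_mult)

lemma eval_diag_left_emb [simp]: "eval_diag (left_emb a) = a"
proof (induction a rule: poly_mapping_single_induct)
  case (single i c)
  then show ?case by (simp add: left_emb_single eval_diag_single mult_single)
qed (simp_all add: left_emb.add eval_diag_add eval_diag.zero left_emb.zero)

lemma x_gen_inv [simp]: "x_gen * x_inv = 1" "x_inv * x_gen = 1"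
  by (simp_all add: x_gen_def x_inv_def mult_single)

text \<open>The step is an equivalence because negative powers of x are reached by going down from
  1.\<close>

lemma laurent_induct [case_names add scale one step]:
  assumes add: "\<And>a b. P a \<Longrightarrow> P b \<Longrightarrow> P (a + b)"
    and scale: "\<And>c a. P a \<Longrightarrow> P (fscale c a)"
    and one: "P 1"
    and step: "\<And>a. P (x_gen * a) \<longleftrightarrow> P a"
  shows "P (a :: 'k::field laurent)"
proof -
  have monomial: "P (Poly_Mapping.single n 1)" for n
  proof (induction n rule: int_induct[where k = 0])
    case base
    then show ?case using one by simp
  next
    case (step1 i)
    then show ?case
      using assms(4)[of "Poly_Mapping.single i 1"] by (simp add: x_gen_def mult_single add.commute)
  next
    case (step2 i)
    then show ?case
      using assms(4)[of "Poly_Mapping.single (i - 1) 1"] by (simp add: x_gen_def mult_single)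
  qed
  show ?thesis
  proof (induction a rule: poly_mapping_single_induct)
    case zero
    then show ?case using scale[OF one, of 0] by simp
  next
    case (single n c)
    then show ?case using scale[OF monomial, of c n] by simp
  qed (rule add)
qed

section \<open>The ideal of the diagonal in A \<otimes> A\<close>

abbreviation diag_gen :: "'k::field laurent laurent" where
  "diag_gen \<equiv> left_emb x_gen - right_emb x_gen"

text \<open>As a simplification rule it cancels the factor \<open>left_emb x_gen\<close> from
  equations with 0, which closes the step cases of \<open>laurent_induct\<close> below.\<close>

lemma left_emb_x_gen_nonzero [simp]: "left_emb x_gen \<noteq> (0 :: 'k::field laurent laurent)"
proof -
  have "left_emb x_gen * left_emb x_inv = (1 :: 'k laurent laurent)"
    by (simp flip: left_emb_mult)
  then show ?thesis by auto
qed

lemma diag_gen_nonzero: "diag_gen \<noteq> (0 :: 'k::field laurent laurent)"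
proof
  assume "diag_gen = (0 :: 'k laurent laurent)"
  then have "Poly_Mapping.lookup (left_emb x_gen) 1 = Poly_Mapping.lookup (right_emb (x_gen :: 'k laurent)) 1"
    by simp
  then show False
    by (simp add: x_gen_def left_emb_single right_emb_def lookup_single)
qed

text \<open>The step rests on xa \<otimes> 1 - 1 \<otimes> xa = (x \<otimes> 1)(a \<otimes> 1 - 1
  \<otimes> a) + (x \<otimes> 1 - 1 \<otimes> x)(1 \<otimes> a); its converse direction uses that x
  \<otimes> 1 is a unit.\<close>

lemma diag_gen_dvd_left_right: "diag_gen dvd left_emb a - right_emb (a :: 'k::field laurent)"
proof (induction a rule: laurent_induct)
  case (add a b)
  then have "diag_gen dvd (left_emb a - right_emb a) + (left_emb b - right_emb b)"
    by (rule dvd_add)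
  then show ?case by (simp add: left_emb.add right_emb_add algebra_simps)
next
  case (scale c a)
  then have "diag_gen dvd const2 c * (left_emb a - right_emb a)"
    by (rule dvd_mult)
  then show ?case by (simp add: left_emb.scale right_emb_fscale right_diff_distrib)
next
  case (step a)
  have eq: "left_emb (x_gen * a) - right_emb (x_gen * a)
      = left_emb x_gen * (left_emb a - right_emb a) + diag_gen * right_emb a"
    by (simp add: left_emb_mult right_emb_mult algebra_simps)
  have unit: "left_emb x_inv * left_emb x_gen = (1 :: 'k laurent laurent)"
    by (simp flip: left_emb_mult)
  show ?case
  proof
    assume "diag_gen dvd left_emb (x_gen * a) - right_emb (x_gen * a)"
    then have "diag_gen dvd left_emb x_gen * (left_emb a - right_emb a)"
      unfolding eq by (simp add: dvd_add_left_iff)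
    then have "diag_gen dvd left_emb x_inv * (left_emb x_gen * (left_emb a - right_emb a))"
      by (rule dvd_mult)
    also have "\<dots> = left_emb a - right_emb a" using unit by (simp flip: mult.assoc)
    finally show "diag_gen dvd left_emb a - right_emb a" .
  next
    assume "diag_gen dvd left_emb a - right_emb a"
    then show "diag_gen dvd left_emb (x_gen * a) - right_emb (x_gen * a)"
      unfolding eq by simp
  qed
qed simp

text \<open>Modulo \<open>diag_gen\<close> the left factor can be moved to the right, so every r is
  congruent to \<open>right_emb (eval_diag r)\<close>.\<close>

lemma eval_diag_eq_0_iff: "eval_diag r = 0 \<longleftrightarrow> diag_gen dvd (r :: 'k::field laurent laurent)"
proof
  have "diag_gen dvd r - right_emb (eval_diag r)"
  proof (induction r rule: poly_mapping_single_induct)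
    case zero
    then show ?case by (simp add: eval_diag.zero right_emb_def)
  next
    case (single i a)
    let ?m = "Poly_Mapping.single i 1 :: 'k laurent"
    have "Poly_Mapping.single i a = left_emb ?m * right_emb a"
      by (simp add: left_emb_single right_emb_def mult_single)
    then have "Poly_Mapping.single i a - right_emb (eval_diag (Poly_Mapping.single i a))
        = (left_emb ?m - right_emb ?m) * right_emb a"
      by (simp add: eval_diag_mult right_emb_mult left_diff_distrib)
    then show ?case using diag_gen_dvd_left_right[of ?m] by (simp add: dvd_mult2)
  next
    case (add r s)
    then have "diag_gen dvd (r - right_emb (eval_diag r)) + (s - right_emb (eval_diag s))"
      by (rule dvd_add)
    then show ?case by (simp add: eval_diag_add right_emb_add algebra_simps)
  qed
  then show "diag_gen dvd r" if "eval_diag r = 0"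
    using that by (simp add: right_emb_def)
qed (auto simp: eval_diag_mult eval_diag.diff)

section \<open>Comparison of the presented bimodule A \<otimes> A with the Laurent polynomial
  model\<close>

definition env_to_ring :: "('k::field laurent \<times> 'k laurent \<Rightarrow>\<^sub>0 'k) \<Rightarrow> 'k laurent laurent" where
  "env_to_ring = lin_ext (\<lambda>c r. const2 c * r) (\<lambda>(u, v). left_emb u * right_emb v)"

text \<open>A section of \<open>env_to_ring\<close> that writes an element as a sum of x^i \<otimes>
  a_i; it is additive only modulo \<open>env_null\<close>.\<close>

definition ring_to_env :: "'k::field laurent laurent \<Rightarrow> ('k laurent \<times> 'k laurent \<Rightarrow>\<^sub>0 'k)" where
  "ring_to_env r = (\<Sum>i\<in>Poly_Mapping.keys r.
     Poly_Mapping.single (Poly_Mapping.single i 1, Poly_Mapping.lookup r i) 1)"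

lemma linear_env_to_ring: "Vector_Spaces.linear fscale (\<lambda>c r. const2 c * r) env_to_ring"
  unfolding env_to_ring_def by (rule linear_lin_ext) unfold_locales

interpretation env_to_ring: Vector_Spaces.linear fscale "\<lambda>c r. const2 c * r" env_to_ring
  by (rule linear_env_to_ring)

lemma env_to_ring_single:
  "env_to_ring (Poly_Mapping.single (u, v) c) = const2 c * (left_emb u * right_emb v)"
  unfolding env_to_ring_def by (subst lin_ext_single) (unfold_locales, simp)

lemma env_to_ring_to_env [simp]: "env_to_ring (ring_to_env r) = r"
  using poly_mapping_eq_sum[of r]
  by (simp add: ring_to_env_def env_to_ring.sum env_to_ring_single left_emb_single right_emb_def mult_single)

lemma ring_to_env_0 [simp]: "ring_to_env 0 = 0"
  by (simp add: ring_to_env_def)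

abbreviation env_null :: "('k::field laurent \<times> 'k laurent \<Rightarrow>\<^sub>0 'k) set" where
  "env_null \<equiv> fs.span laurent.env_relators"

lemma env_null_relators:
  "Poly_Mapping.single (a + a', b) 1 - Poly_Mapping.single (a, b) 1 - Poly_Mapping.single (a', b) 1 \<in> env_null"
  "Poly_Mapping.single (a, b + b') 1 - Poly_Mapping.single (a, b) 1 - Poly_Mapping.single (a, b') 1 \<in> env_null"
  "Poly_Mapping.single (fscale c a, b) 1 - Poly_Mapping.single (a, b) c \<in> env_null"
  "Poly_Mapping.single (a, fscale c b) 1 - Poly_Mapping.single (a, b) c \<in> env_null"
  unfolding laurent.env_relators_def by (rule fs.span_base; blast)+

lemma ring_to_env_superset:
  assumes "finite K" "Poly_Mapping.keys r \<subseteq> K"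
  shows "(\<Sum>i\<in>K. Poly_Mapping.single (Poly_Mapping.single i 1, Poly_Mapping.lookup r i) 1) - ring_to_env r \<in> env_null"
proof -
  have "(\<Sum>i\<in>K. Poly_Mapping.single (Poly_Mapping.single i 1, Poly_Mapping.lookup r i) 1) - ring_to_env r
      = (\<Sum>i\<in>K - Poly_Mapping.keys r. Poly_Mapping.single (Poly_Mapping.single i 1, Poly_Mapping.lookup r i) 1)"
    using assms by (simp add: ring_to_env_def sum_diff)
  also have "\<dots> \<in> env_null"
    using env_null_relators(4)[where c = 0 and b = 0]
    by (intro fs.span_sum) (auto simp: in_keys_iff)
  finally show ?thesis .
qed

lemma ring_to_env_add: "ring_to_env (r + s) - (ring_to_env r + ring_to_env s) \<in> env_null"
proof -
  let ?K = "Poly_Mapping.keys r \<union> Poly_Mapping.keys s"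
  let ?m = "\<lambda>i. Poly_Mapping.single i 1 :: 'a laurent"
  let ?s = "\<lambda>r. \<Sum>i\<in>?K. Poly_Mapping.single (?m i, Poly_Mapping.lookup r i) (1 :: 'a)"
  have "(\<Sum>i\<in>?K. Poly_Mapping.single (?m i, Poly_Mapping.lookup r i + Poly_Mapping.lookup s i) 1
      - Poly_Mapping.single (?m i, Poly_Mapping.lookup r i) 1
      - Poly_Mapping.single (?m i, Poly_Mapping.lookup s i) (1::'a)) \<in> env_null"
    by (intro fs.span_sum env_null_relators)
  then have 1: "?s (r + s) - ?s r - ?s s \<in> env_null"
    by (simp add: sum_subtractf lookup_add)
  have 2: "?s r - ring_to_env r \<in> env_null" "?s s - ring_to_env s \<in> env_null"
    "?s (r + s) - ring_to_env (r + s) \<in> env_null"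
    using keys_add[of r s] by (auto intro!: ring_to_env_superset)
  have "ring_to_env (r + s) - (ring_to_env r + ring_to_env s)
      = (?s (r + s) - ?s r - ?s s) - (?s (r + s) - ring_to_env (r + s))
       + (?s r - ring_to_env r) + (?s s - ring_to_env s)"
    by simp
  also have "\<dots> \<in> env_null"
    by (intro fs.span_add fs.span_diff 1 2)
  finally show ?thesis .
qed

text \<open>By additivity in u the essential case is u = c x^i, where the scalar c is moved across
  the tensor sign into v.\<close>

lemma ring_to_env_tensor:
  "Poly_Mapping.single (u, v) 1 - ring_to_env (left_emb u * right_emb v) \<in> env_null"
proof (induction u rule: poly_mapping_single_induct)
  case zero
  then show ?case using env_null_relators(3)[of 0 0] by simp
next
  case (single i c)
  let ?m = "Poly_Mapping.single i 1 :: 'a laurent"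
  have "left_emb (Poly_Mapping.single i c) * right_emb v = Poly_Mapping.single i (fscale c v)"
    by (simp add: left_emb_single right_emb_def mult_single fscale_eq_mult)
  moreover have "Poly_Mapping.single (?m, fscale c v) 1 - ring_to_env (Poly_Mapping.single i (fscale c v)) \<in> env_null"
    using ring_to_env_superset[of "{i}" "Poly_Mapping.single i (fscale c v)"] by simp
  moreover have "Poly_Mapping.single (Poly_Mapping.single i c, v) 1 - Poly_Mapping.single (?m, fscale c v) 1 \<in> env_null"
    using fs.span_diff[OF env_null_relators(3)[of c ?m v] env_null_relators(4)[of ?m c v]] by simp
  ultimately show ?case
    using fs.span_add by (metis (no_types, lifting) diff_add_cancel add_diff_eq)
next
  case (add u u')
  have "Poly_Mapping.single (u + u', v) 1 - ring_to_env (left_emb (u + u') * right_emb v)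
    = (Poly_Mapping.single (u + u', v) 1 - Poly_Mapping.single (u, v) 1 - Poly_Mapping.single (u', v) 1)
     + (Poly_Mapping.single (u, v) 1 - ring_to_env (left_emb u * right_emb v))
     + (Poly_Mapping.single (u', v) 1 - ring_to_env (left_emb u' * right_emb v))
     - (ring_to_env (left_emb u * right_emb v + left_emb u' * right_emb v)
       - (ring_to_env (left_emb u * right_emb v) + ring_to_env (left_emb u' * right_emb v)))"
    by (simp add: left_emb.add distrib_right)
  also have "\<dots> \<in> env_null"
    by (intro fs.span_add fs.span_diff env_null_relators ring_to_env_add add)
  finally show ?case .
qed

lemma ring_to_env_to_ring: "p - ring_to_env (env_to_ring p) \<in> env_null"
proof (induction p rule: poly_mapping_single_induct)
  case zero
  then show ?case by (simp add: env_to_ring.zero fs.span_zero)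
next
  case (single uv c)
  obtain u v where [simp]: "uv = (u, v)" by (cases uv)
  have "Poly_Mapping.single (u, v) c - ring_to_env (env_to_ring (Poly_Mapping.single uv c))
    = (Poly_Mapping.single (fscale c u, v) 1 - ring_to_env (left_emb (fscale c u) * right_emb v))
      - (Poly_Mapping.single (fscale c u, v) 1 - Poly_Mapping.single (u, v) c)"
    by (simp add: env_to_ring_single left_emb.scale mult.assoc)
  also have "\<dots> \<in> env_null"
    by (intro fs.span_diff ring_to_env_tensor env_null_relators)
  finally show ?case by simp
next
  case (add p q)
  have "p + q - ring_to_env (env_to_ring (p + q))
     = (p - ring_to_env (env_to_ring p)) + (q - ring_to_env (env_to_ring q))
      - (ring_to_env (env_to_ring p + env_to_ring q) - (ring_to_env (env_to_ring p) + ring_to_env (env_to_ring q)))"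
    by (simp add: env_to_ring.add)
  also have "\<dots> \<in> env_null"
    by (intro fs.span_add fs.span_diff ring_to_env_add add)
  finally show ?case .
qed

text \<open>From here on, congruence in \<open>env\<close> is equality in a domain. The direction
  from right to left needs that \<open>ring_to_env\<close> inverts \<open>env_to_ring\<close> modulo
  relations.\<close>

lemma env_null_iff: "p \<in> env_null \<longleftrightarrow> env_to_ring p = 0"
proof
  assume "p \<in> env_null"
  then show "env_to_ring p = 0"
  proof (rule env_to_ring.eq_0_on_span[rotated])
    fix r :: "'a laurent \<times> 'a laurent \<Rightarrow>\<^sub>0 'a" assume "r \<in> laurent.env_relators"
    then show "env_to_ring r = 0"
      unfolding laurent.env_relators_def
      by (auto simp: env_to_ring.diff env_to_ring_single left_emb.add right_emb_add
          left_emb.scale right_emb_fscale distrib_left distrib_right mult.left_commute)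
  qed
next
  assume "env_to_ring p = 0"
  then show "p \<in> env_null" using ring_to_env_to_ring[of p] by simp
qed

lemma bcar_env [simp]: "bcar laurent.env = UNIV"
  by (simp add: laurent.env_def)

lemma bcong_env: "bcong laurent.env p q \<longleftrightarrow> env_to_ring p = env_to_ring q"
  by (simp add: bcong_def laurent.env_def env_null_iff env_to_ring.diff)

lemma linear_lact_env: "Vector_Spaces.linear fscale fscale (lact laurent.env a)"
  by (simp add: laurent.env_def linear_lin_ext fs.vector_space_axioms)

lemma linear_ract_env: "Vector_Spaces.linear fscale fscale (ract laurent.env a)"
  by (simp add: laurent.env_def linear_lin_ext fs.vector_space_axioms)

lemma env_to_ring_lact: "env_to_ring (lact laurent.env a p) = left_emb a * env_to_ring p"
proof (rule linear_eq_on_keys[where p = p and s = "\<lambda>c r. const2 c * r"])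
  show "Vector_Spaces.linear fscale (\<lambda>c r. const2 c * r) (\<lambda>p. env_to_ring (lact laurent.env a p))"
    using Vector_Spaces.linear_compose[OF linear_lact_env linear_env_to_ring] by (simp add: o_def)
  show "Vector_Spaces.linear fscale (\<lambda>c r. const2 c * r) (\<lambda>p. left_emb a * env_to_ring p)"
    by (simp add: Vector_Spaces.linear_iff fs.vector_space_axioms ring2.vector_space_axioms
        env_to_ring.add env_to_ring.scale distrib_left mult.left_commute)
  fix uv :: "'a laurent \<times> 'a laurent"
  show "env_to_ring (lact laurent.env a (Poly_Mapping.single uv 1)) = left_emb a * env_to_ring (Poly_Mapping.single uv 1)"
    by (cases uv) (simp add: laurent.env_def lin_ext_single[OF fs.vector_space_axioms] env_to_ring_single
        left_emb_mult)
qed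

lemma env_to_ring_ract: "env_to_ring (ract laurent.env a p) = right_emb a * env_to_ring p"
proof (rule linear_eq_on_keys[where p = p and s = "\<lambda>c r. const2 c * r"])
  show "Vector_Spaces.linear fscale (\<lambda>c r. const2 c * r) (\<lambda>p. env_to_ring (ract laurent.env a p))"
    using Vector_Spaces.linear_compose[OF linear_ract_env linear_env_to_ring] by (simp add: o_def)
  show "Vector_Spaces.linear fscale (\<lambda>c r. const2 c * r) (\<lambda>p. right_emb a * env_to_ring p)"
    by (simp add: Vector_Spaces.linear_iff fs.vector_space_axioms ring2.vector_space_axioms
        env_to_ring.add env_to_ring.scale distrib_left mult.left_commute)
  fix uv :: "'a laurent \<times> 'a laurent"
  show "env_to_ring (ract laurent.env a (Poly_Mapping.single uv 1)) = right_emb a * env_to_ring (Poly_Mapping.single uv 1)"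
    by (cases uv) (simp add: laurent.env_def lin_ext_single[OF fs.vector_space_axioms] env_to_ring_single
        right_emb_mult)
qed

lemma env_act_0 [simp]: "lact laurent.env a 0 = 0" "ract laurent.env a 0 = 0"
  by (simp_all add: laurent.env_def lin_ext_def)

section \<open>Hochschild cochains with values in the enveloping algebra\<close>

lemma signed_0 [simp]: "signed i 0 = 0" "signed 0 a = a"
  and signed_add: "signed i (a + b) = signed i a + signed i (b :: 'v::ab_group_add)"
  and signed_diff: "signed i (a - b) = signed i a - signed i b"
  and signed_Suc: "signed (Suc i) a = - signed i a"
  and mult_signed: "r * signed i s = signed i (r * s :: 'r::ring)"
  by (simp_all add: signed_def)

text \<open>The cochain conditions of \<open>cochains\<close> after transport to the ring.
  Normalization is asked at 1 only; other scalars follow by homogeneity.\<close>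

definition multilinear :: "('k::field laurent list \<Rightarrow> 'k laurent laurent) \<Rightarrow> bool" where
  "multilinear F \<longleftrightarrow>
     (\<forall>as i a b. i < length as \<longrightarrow> F (as[i := a + b]) = F (as[i := a]) + F (as[i := b])) \<and>
     (\<forall>as i c a. i < length as \<longrightarrow> F (as[i := fscale c a]) = const2 c * F (as[i := a])) \<and>
     (\<forall>as i. i < length as \<longrightarrow> F (as[i := 1]) = 0)"

lemma multilinear_add: "multilinear F \<Longrightarrow> i < length as \<Longrightarrow> F (as[i := a + b]) = F (as[i := a]) + F (as[i := b])"
  and multilinear_scale: "multilinear F \<Longrightarrow> i < length as \<Longrightarrow> F (as[i := fscale c a]) = const2 c * F (as[i := a])"
  and multilinear_one: "multilinear F \<Longrightarrow> i < length as \<Longrightarrow> F (as[i := 1]) = 0"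
  by (auto simp: multilinear_def)

text \<open>The Hochschild differential transported along \<open>env_to_ring\<close>; the right
  action also becomes a multiplication from the left, the ring being commutative.\<close>

definition coboundary :: "('k::field laurent list \<Rightarrow> 'k laurent laurent) \<Rightarrow> 'k laurent list \<Rightarrow> 'k laurent laurent" where
  "coboundary F as =
     (if as = [] then 0
      else left_emb (hd as) * F (tl as)
       + (\<Sum>i<length as - 1. signed (Suc i) (F (merge_adjacent i as)))
       + signed (length as) (right_emb (last as) * F (butlast as)))"

lemma env_to_ring_signed: "env_to_ring (signed i p) = signed i (env_to_ring p)"
  by (simp add: signed_def env_to_ring.neg)

lemma env_to_ring_cochain_diff:
  "env_to_ring (laurent.cochain_diff laurent.env \<phi> as) = coboundary (\<lambda>as. env_to_ring (\<phi> as)) as"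
proof (cases as)
  case (Cons a bs)
  then show ?thesis
    by (simp add: laurent.cochain_diff_def coboundary_def Let_def env_to_ring.add env_to_ring.sum
        env_to_ring_signed env_to_ring_lact env_to_ring_ract)
qed (simp add: laurent.cochain_diff_def coboundary_def env_to_ring.zero)

lemma cochains_env_iff:
  "\<phi> \<in> laurent.cochains laurent.env p \<longleftrightarrow>
     (\<forall>as. int (length as) \<noteq> p \<longrightarrow> \<phi> as = 0) \<and> multilinear (\<lambda>as. env_to_ring (\<phi> as))"
proof -
  \<comment> \<open>After homogeneity the normalization clause says that all \<open>const2 c\<close>
    vanish or F vanishes at the unit; c = 1 excludes the first alternative.\<close>
  have nonzero: "(\<forall>c. const2 (c :: 'a) = 0) \<longleftrightarrow> False" using const2_1 by (metis zero_neq_one)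
  show ?thesis
    unfolding laurent.cochains_def multilinear_def bcong_env
    by (simp add: env_to_ring.add env_to_ring.zero env_to_ring_lact left_emb_const nonzero cong: conj_cong)
qed

lemma cocycles_env_iff:
  "\<phi> \<in> laurent.cocycles laurent.env p \<longleftrightarrow>
     \<phi> \<in> laurent.cochains laurent.env p \<and> (\<forall>as. coboundary (\<lambda>as. env_to_ring (\<phi> as)) as = 0)"
  by (simp add: laurent.cocycles_def bcong_env env_to_ring_cochain_diff env_to_ring.zero)

text \<open>A ring-valued primitive is lifted value by value with \<open>ring_to_env\<close>. That
  the lift is not additive does no harm, since cochain conditions are tested after
  \<open>env_to_ring\<close>.\<close>

lemma coboundaries_envI:
  assumes "\<phi> \<in> laurent.cochains laurent.env p" "multilinear F"
    "\<And>as. int (length as) \<noteq> p - 1 \<Longrightarrow> F as = 0"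
    "\<And>as. coboundary F as = env_to_ring (\<phi> as)"
  shows "\<phi> \<in> laurent.coboundaries laurent.env p"
proof -
  have "(\<lambda>as. ring_to_env (F as)) \<in> laurent.cochains laurent.env (p - 1)"
    using assms by (simp add: cochains_env_iff)
  then show ?thesis
    unfolding laurent.coboundaries_def using assms(1,4)
    by (auto simp: bcong_env env_to_ring_cochain_diff intro!: bexI[of _ "\<lambda>as. ring_to_env (F as)"])
qed

lemma cocycles_env_diff: "u \<in> laurent.cocycles laurent.env p \<Longrightarrow> v \<in> laurent.cocycles laurent.env p
  \<Longrightarrow> u - v \<in> laurent.cocycles laurent.env p"
proof -
  assume uv: "u \<in> laurent.cocycles laurent.env p" "v \<in> laurent.cocycles laurent.env p"
  have "coboundary (\<lambda>as. env_to_ring ((u - v) as)) as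
    = coboundary (\<lambda>as. env_to_ring (u as)) as - coboundary (\<lambda>as. env_to_ring (v as)) as" for as
    by (simp add: coboundary_def env_to_ring.diff signed_diff sum_subtractf right_diff_distrib)
  then show ?thesis
    using uv by (simp add: cocycles_env_iff cochains_env_iff multilinear_def env_to_ring.diff right_diff_distrib)
qed

text \<open>Every cochain in degree at least two is cobounded by solving the first-argument recursion
  \<open>G (x b, \<dots>) = x G (b, \<dots>) - F (x, b, \<dots>)\<close> with \<open>G (1, \<dots>) = 0\<close>; the sums below are its
  solution on the monomials \<open>b = x\<^sup>n\<close>, for positive and for negative \<open>n\<close>.\<close>

definition contract_monomial ::
  "('k::field laurent list \<Rightarrow> 'k laurent laurent) \<Rightarrow> 'k laurent list \<Rightarrow> int \<Rightarrow> 'k laurent laurent" where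
  "contract_monomial F cs n =
     (\<Sum>j\<in>{n..<0}. Poly_Mapping.single (n - j - 1) 1 * F (x_gen # Poly_Mapping.single j 1 # cs))
     - (\<Sum>j\<in>{0..<n}. Poly_Mapping.single (n - j - 1) 1 * F (x_gen # Poly_Mapping.single j 1 # cs))"

definition contract ::
  "('k::field laurent list \<Rightarrow> 'k laurent laurent) \<Rightarrow> 'k laurent list \<Rightarrow> 'k laurent laurent" where
  "contract F as = (case as of [] \<Rightarrow> 0
     | a # cs \<Rightarrow> lin_ext (\<lambda>c r. const2 c * r) (contract_monomial F cs) a)"

lemma contract_Nil [simp]: "contract F [] = 0"
  by (simp add: contract_def)

lemma linear_contract: "Vector_Spaces.linear fscale (\<lambda>c r. const2 c * r) (\<lambda>a. contract F (a # cs))"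
  by (simp add: contract_def linear_lin_ext ring2.vector_space_axioms)

lemma contract_single: "contract F (Poly_Mapping.single n 1 # cs) = contract_monomial F cs n"
  by (simp add: contract_def lin_ext_single ring2.vector_space_axioms)

lemma left_emb_x_gen: "left_emb x_gen = Poly_Mapping.single 1 1"
  by (simp add: x_gen_def left_emb_single)

lemma contract_monomial_Suc:
  "contract_monomial F cs (n + 1)
     = left_emb x_gen * contract_monomial F cs n - F (x_gen # Poly_Mapping.single n 1 # cs)"
proof -
  let ?h = "\<lambda>j. F (x_gen # Poly_Mapping.single j 1 # cs)"
  have shift: "left_emb x_gen * (Poly_Mapping.single (n - j - 1) 1 * ?h j)
      = Poly_Mapping.single (n + 1 - j - 1) 1 * ?h j" for j
    by (simp add: left_emb_x_gen mult_single flip: mult.assoc)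
  show ?thesis
  proof (cases "n \<ge> 0")
    case True
    then have "{0..<n + 1} = insert n {0..<n}" "{n..<0} = {}" "{n + 1..<0} = {}" by auto
    then show ?thesis
      by (simp add: contract_monomial_def sum_distrib_left shift right_diff_distrib)
  next
    case False
    then have "{n..<0} = insert n {n + 1..<0}" "{0..<n} = {}" "{0..<n + 1} = {}" by auto
    \<comment> \<open>The summand j = n of \<open>contract_monomial\<close> carries the exponent -1;
      multiplied by x it becomes F(x, x^n, ...), the term that the recursion subtracts.\<close>
    moreover have "left_emb x_gen * Poly_Mapping.single (- 1) 1 = (1 :: 'a laurent laurent)"
      by (simp add: left_emb_x_gen mult_single)
    ultimately show ?thesis
      by (simp add: contract_monomial_def sum_distrib_left shift distrib_left)
  qed
qed

lemma multilinear_linear_second: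
  assumes "multilinear F"
  shows "Vector_Spaces.linear fscale (\<lambda>c r. const2 c * r) (\<lambda>a. F (b # a # cs))"
  using multilinear_add[OF assms, of 1 "b # 0 # cs"] multilinear_scale[OF assms, of 1 "b # 0 # cs"]
  by (simp add: Vector_Spaces.linear_iff fs.vector_space_axioms ring2.vector_space_axioms)

lemma contract_step:
  assumes "multilinear F"
  shows "contract F (x_gen * a # cs) = left_emb x_gen * contract F (a # cs) - F (x_gen # a # cs)"
proof (rule linear_eq_on_keys[where p = a and s = "\<lambda>c r. const2 c * r"])
  interpret c: Vector_Spaces.linear fscale "\<lambda>c r. const2 c * r" "\<lambda>a. contract F (a # cs)"
    by (rule linear_contract)
  interpret f: Vector_Spaces.linear fscale "\<lambda>c r. const2 c * r" "\<lambda>a. F (x_gen # a # cs)"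
    by (rule multilinear_linear_second) fact
  show "Vector_Spaces.linear fscale (\<lambda>c r. const2 c * r) (\<lambda>a. contract F (x_gen * a # cs))"
    by (simp add: Vector_Spaces.linear_iff fs.vector_space_axioms ring2.vector_space_axioms
        distrib_left c.add c.scale laurent.scale_mult_right)
  show "Vector_Spaces.linear fscale (\<lambda>c r. const2 c * r)
     (\<lambda>a. left_emb x_gen * contract F (a # cs) - F (x_gen # a # cs))"
    by (simp add: Vector_Spaces.linear_iff fs.vector_space_axioms ring2.vector_space_axioms
        distrib_left c.add c.scale f.add f.scale right_diff_distrib mult.left_commute)
  fix n
  have "x_gen * Poly_Mapping.single n 1 = Poly_Mapping.single (n + 1) (1::'a)"
    by (simp add: x_gen_def mult_single add.commute)
  then show "contract F (x_gen * Poly_Mapping.single n 1 # cs)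
     = left_emb x_gen * contract F (Poly_Mapping.single n 1 # cs) - F (x_gen # Poly_Mapping.single n 1 # cs)"
    by (simp add: contract_single contract_monomial_Suc)
qed

lemma contract_one: "contract F (1 # cs) = 0"
  using contract_single[of F 0 cs] by (simp add: contract_monomial_def)

lemma multilinear_contract:
  assumes "multilinear F"
  shows "multilinear (contract F)"
proof -
  \<comment> \<open>Slot k of the remaining arguments \<open>cs\<close> is slot k+2 of the list fed
    to F.\<close>
  note F = multilinear_add[OF assms, of "Suc (Suc k)" "x_gen # b # cs" for k b cs, simplified]
    multilinear_scale[OF assms, of "Suc (Suc k)" "x_gen # b # cs" for k b cs, simplified]
    multilinear_one[OF assms, of "Suc (Suc k)" "x_gen # b # cs" for k b cs, simplified]
  have mon: "contract_monomial F (cs[k := a + b]) n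
      = contract_monomial F (cs[k := a]) n + contract_monomial F (cs[k := b]) n"
    "contract_monomial F (cs[k := fscale c a]) n = const2 c * contract_monomial F (cs[k := a]) n"
    "contract_monomial F (cs[k := 1]) n = 0"
    if "k < length cs" for cs k a b c n
    using that
    by (simp_all add: contract_monomial_def F distrib_left sum.distrib sum_distrib_left
        right_diff_distrib mult.left_commute)
  interpret c: Vector_Spaces.linear fscale "\<lambda>c r. const2 c * r" "\<lambda>a. contract F (a # cs)" for cs
    by (rule linear_contract)
  show ?thesis
    unfolding multilinear_def
  proof (intro conjI allI impI)
    fix as :: "'a laurent list" and i a b c
    assume i: "i < length as"
    then obtain a0 cs where as: "as = a0 # cs" by (cases as) auto
    show "contract F (as[i := a + b]) = contract F (as[i := a]) + contract F (as[i := b])"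
      using i by (cases i) (simp_all add: as c.add, simp add: contract_def lin_ext_def mon distrib_left sum.distrib)
    show "contract F (as[i := fscale c a]) = const2 c * contract F (as[i := a])"
      using i by (cases i)
        (simp_all add: as c.scale, simp add: contract_def lin_ext_def mon sum_distrib_left mult.left_commute)
    show "contract F (as[i := 1]) = 0"
      using i by (cases i) (simp_all add: as contract_one, simp add: contract_def lin_ext_def mon)
  qed
qed

text \<open>The faces that leave the first argument alone, so that any rule for the first slot can
  be applied to each of them. The index of a face drops by one and its sign flips twice, hence the
  plain sign i.\<close>

definition coboundary_tail ::
  "('k::field laurent list \<Rightarrow> 'k laurent laurent) \<Rightarrow> 'k laurent \<Rightarrow> 'k laurent list \<Rightarrow> 'k laurent laurent" where
  "coboundary_tail F a bs =
     (\<Sum>i<length bs - 1. signed i (F (a # merge_adjacent i bs)))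
     + signed (Suc (length bs)) (right_emb (last bs) * F (a # butlast bs))"

lemma coboundary_Cons:
  assumes "bs \<noteq> []"
  shows "coboundary F (a # bs)
     = left_emb a * F bs - F ((a * hd bs) # tl bs) + coboundary_tail F a bs"
proof -
  obtain b cs where bs: "bs = b # cs" using assms by (cases bs) auto
  have merge: "merge_adjacent (Suc i) (a # b # cs) = a # merge_adjacent i (b # cs)" for i
    by (simp add: merge_adjacent_def)
  have "merge_adjacent 0 (a # b # cs) = (a * b) # cs"
    by (simp add: merge_adjacent_def)
  then show ?thesis
    by (simp add: coboundary_def coboundary_tail_def bs merge sum.lessThan_Suc_shift signed_Suc
        del: sum.lessThan_Suc)
qed

text \<open>The defect E(a), the coboundary of the contraction minus F at (a, ...), is linear in a,
  vanishes at a = 1 and satisfies E(x a) = x E(a), by the recursion and the cocycle identity at (x,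
  a, ...); hence it is zero. Degrees 0 and 1 are excluded because the contraction vanishes on the
  empty list, so its coboundary is zero on lists of length one.\<close>

theorem coboundary_contract:
  fixes F :: "'k::field laurent list \<Rightarrow> 'k laurent laurent"
  assumes F: "multilinear F" and cocycle: "\<And>as. coboundary F as = 0"
    and low: "F [] = 0" "\<And>a. F [a] = 0"
  shows "coboundary (contract F) as = F as"
proof (cases as)
  case Nil
  then show ?thesis by (simp add: coboundary_def low)
next
  case (Cons a bs)
  show ?thesis
  proof (cases "bs = []")
    case True
    then show ?thesis by (simp add: Cons coboundary_def low signed_def)
  next
    case False
    then have hd_tl: "hd bs # tl bs = bs" by simp
    let ?G = "contract F"
    interpret c: Vector_Spaces.linear fscale "\<lambda>c r. const2 c * r" "\<lambda>a. ?G (a # cs)" for cs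
      by (rule linear_contract)
    \<comment> \<open>Applying the recursion to each face collects F(x, a, ...) terms. They are the
      faces in \<open>coboundary_tail F x_gen (a # bs)\<close> apart from the one merging a with the
      head of \<open>bs\<close>, which is therefore split off.\<close>
    have tail: "coboundary_tail ?G (x_gen * a) bs = left_emb x_gen * coboundary_tail ?G a bs
       - (F (x_gen # (a * hd bs) # tl bs) - coboundary_tail F x_gen (a # bs))" for a
    proof -
      have merge: "merge_adjacent (Suc i) (a # bs) = a # merge_adjacent i bs" for i
        by (simp add: merge_adjacent_def)
      have "merge_adjacent 0 (a # bs) = (a * hd bs) # tl bs"
        using False by (cases bs) (simp_all add: merge_adjacent_def)
      moreover obtain m where "length bs = Suc m" using False by (cases bs) auto
      ultimately show ?thesis
        using False
        by (simp add: coboundary_tail_def merge contract_step[OF F] signed_diff sum_subtractf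
            sum.lessThan_Suc_shift right_diff_distrib distrib_left sum_distrib_left mult_signed
            signed_Suc sum_negf mult.left_commute del: sum.lessThan_Suc)
    qed
    have F1: "left_emb x_gen * F (a # bs) - F ((x_gen * a) # bs) + coboundary_tail F x_gen (a # bs) = 0" for a
      using cocycle[of "x_gen # a # bs"] by (simp add: coboundary_Cons)
    have step: "coboundary ?G ((x_gen * a) # bs) - F ((x_gen * a) # bs)
        = left_emb x_gen * (coboundary ?G (a # bs) - F (a # bs))" for a
      using F1[of a] False
      by (simp add: coboundary_Cons tail contract_step[OF F] mult.assoc left_emb_mult algebra_simps)
    have F0: "F ((a + b) # bs) = F (a # bs) + F (b # bs)" "F (fscale c a # bs) = const2 c * F (a # bs)"
      "F (1 # bs) = 0" for a b c
      using multilinear_add[OF F, of 0 "0 # bs"] multilinear_scale[OF F, of 0 "0 # bs"]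
        multilinear_one[OF F, of 0 "0 # bs"] by simp_all
    have "coboundary ?G (a # bs) - F (a # bs) = 0"
    proof (induction a rule: laurent_induct)
      case (add a b)
      have "coboundary ?G ((a + b) # bs) = coboundary ?G (a # bs) + coboundary ?G (b # bs)"
        using False by (simp add: coboundary_Cons coboundary_tail_def left_emb.add distrib_left distrib_right
            c.add signed_add sum.distrib)
      with add show ?case by (simp add: F0)
    next
      case (scale c a)
      have "coboundary ?G (fscale c a # bs) = const2 c * coboundary ?G (a # bs)"
        using False by (simp add: coboundary_Cons coboundary_tail_def left_emb.scale laurent.scale_mult_left
            c.scale mult_signed sum_distrib_left distrib_left right_diff_distrib mult.assoc mult.left_commute)
      with scale show ?case by (simp add: F0)
    next
      case one
      show ?case
        using False by (simp add: coboundary_Cons coboundary_tail_def contract_one F0 hd_tl)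
    next
      case (step a)
      show ?case unfolding \<open>\<And>a. coboundary ?G ((x_gen * a) # bs) - F ((x_gen * a) # bs)
        = left_emb x_gen * (coboundary ?G (a # bs) - F (a # bs))\<close> by simp
    qed
    then show ?thesis by (simp add: Cons)
  qed
qed

lemma cocycles_env_high:
  assumes "p \<ge> 2" "\<phi> \<in> laurent.cocycles laurent.env p"
  shows "\<phi> \<in> laurent.coboundaries laurent.env p"
proof -
  let ?F = "\<lambda>as. env_to_ring (\<phi> as)"
  have ch: "\<phi> \<in> laurent.cochains laurent.env p" and d: "\<And>as. coboundary ?F as = 0"
    using assms(2) by (auto simp: cocycles_env_iff)
  then have F: "multilinear ?F" and deg: "\<And>as. int (length as) \<noteq> p \<Longrightarrow> ?F as = 0"
    by (auto simp: cochains_env_iff env_to_ring.zero)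
  show ?thesis
  proof (rule coboundaries_envI[OF ch multilinear_contract[OF F]])
    \<comment> \<open>The bound 2 on p makes F vanish on lists of length at most one.\<close>
    show "coboundary (contract ?F) as = ?F as" for as
      using assms(1) by (intro coboundary_contract F d deg) auto
    fix as :: "'a laurent list" assume "int (length as) \<noteq> p - 1"
    then show "contract ?F as = 0"
      by (cases as) (auto simp: contract_def lin_ext_def contract_monomial_def deg)
  qed
qed

text \<open>Negative degrees need no separate treatment: only the value at the empty list could
  survive, and the cocycle condition at \<open>[x_gen]\<close> makes \<open>diag_gen\<close>
  annihilate it.\<close>

lemma cocycles_env_low:
  assumes "p \<le> 0" "\<phi> \<in> laurent.cocycles laurent.env p"
  shows "\<phi> \<in> laurent.coboundaries laurent.env p"
proof -
  let ?F = "\<lambda>as. env_to_ring (\<phi> as)"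
  have ch: "\<phi> \<in> laurent.cochains laurent.env p" and d: "\<And>as. coboundary ?F as = 0"
    using assms(2) by (auto simp: cocycles_env_iff)
  have deg: "as \<noteq> [] \<Longrightarrow> ?F as = 0" for as
    using ch assms(1) by (cases as) (auto simp: cochains_env_iff env_to_ring.zero)
  have "diag_gen * ?F [] = 0"
    using d[of "[x_gen]"] by (simp add: coboundary_def signed_def algebra_simps)
  then have "?F as = 0" for as
    using diag_gen_nonzero deg by (cases "as = []") auto
  then show ?thesis
    by (intro coboundaries_envI[OF ch, of "\<lambda>_. 0"]) (simp_all add: multilinear_def coboundary_def)
qed

section \<open>Non-degeneracy\<close>

lemma length_merge_adjacent: "Suc i < length as \<Longrightarrow> length (merge_adjacent i as) = length as - 1"
  by (simp add: merge_adjacent_def)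

lemma coboundary_degree:
  assumes "\<And>as. length as \<noteq> n \<Longrightarrow> F as = 0" "length as \<noteq> Suc n"
  shows "coboundary F as = 0"
proof (cases "as = []")
  case False
  with assms(2) have "length as - 1 \<noteq> n" by (cases as) auto
  then have "F (tl as) = 0" "F (butlast as) = 0" "\<And>i. i < length as - 1 \<Longrightarrow> F (merge_adjacent i as) = 0"
    by (intro assms(1); simp add: length_merge_adjacent)+
  then show ?thesis by (simp add: coboundary_def)
qed (simp add: coboundary_def)

text \<open>By commutativity v h u = h (u v), so \<open>flat\<close> sees the values of a cochain
  only through the multiplication map.\<close>

lemma lin_ext_env_eq_eval_diag:
  "lin_ext fscale (\<lambda>(u, v). v * h * u) p = h * eval_diag (env_to_ring p)"
proof (rule linear_eq_on_keys[where p = p and s = fscale])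
  show "Vector_Spaces.linear fscale fscale (lin_ext fscale (\<lambda>(u, v). v * h * u))"
    by (rule linear_lin_ext) unfold_locales
  show "Vector_Spaces.linear fscale fscale (\<lambda>p. h * eval_diag (env_to_ring p))"
    by (simp add: Vector_Spaces.linear_iff fs.vector_space_axioms env_to_ring.add env_to_ring.scale
        eval_diag.add eval_diag.scale distrib_left laurent.scale_mult_right)
  fix uv :: "'a laurent \<times> 'a laurent"
  show "lin_ext fscale (\<lambda>(u, v). v * h * u) (Poly_Mapping.single uv 1)
      = h * eval_diag (env_to_ring (Poly_Mapping.single uv 1))"
    by (cases uv) (simp add: lin_ext_single fs.vector_space_axioms env_to_ring_single eval_diag_mult
        ac_simps)
qed

lemma alpha_1: "alpha (Suc 0) = fscale (1 / 2)
    (Poly_Mapping.single [x_inv, x_gen] 1 - Poly_Mapping.single [x_gen, x_inv] 1)"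
  by (simp add: alpha_def)

lemma fscale_half_add: "fscale (1 / 2) r + fscale (1 / 2) r = (r :: 'x \<Rightarrow>\<^sub>0 'k::field_char_0)"
  by (simp flip: fs.scale_left_distrib)

lemma flat_alpha_1:
  "laurent.flat (alpha (Suc 0)) \<phi> = fscale (1 / 2)
     (x_inv * eval_diag (env_to_ring (\<phi> [x_gen])) - x_gen * eval_diag (env_to_ring (\<phi> [x_inv])))"
proof -
  interpret l: Vector_Spaces.linear fscale fscale "\<lambda>c. laurent.flat c \<phi>"
    unfolding laurent.flat_def by (rule linear_lin_ext) unfold_locales
  have "laurent.flat (Poly_Mapping.single as 1) \<phi> = hd as * eval_diag (env_to_ring (\<phi> (tl as)))"
    for as :: "'a laurent list"
    unfolding laurent.flat_def by (subst lin_ext_single) (unfold_locales, simp add: lin_ext_env_eq_eval_diag)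
  then show ?thesis
    unfolding alpha_1 by (simp only: l.scale l.diff list.sel)
qed

lemma derivation_mult:
  assumes "\<And>as. coboundary F as = 0"
  shows "F [a * b] = left_emb a * F [b] + right_emb b * F [a]"
proof -
  have "left_emb a * F [b] + right_emb b * F [a] - F [a * b] = 0"
    using assms[of "[a, b]"] by (simp add: coboundary_def merge_adjacent_def signed_def algebra_simps)
  then show ?thesis by simp
qed

text \<open>From D(x x^-1) = D(1) = 0 the two halves of the pairing with \<open>alpha 1\<close> are
  equal, and the factor 1/2 disappears.\<close>

lemma flat_alpha_1_cocycle:
  fixes \<phi> :: "'k::field_char_0 laurent list \<Rightarrow> _"
  assumes "\<phi> \<in> laurent.cocycles laurent.env 1"
  shows "laurent.flat (alpha (Suc 0)) \<phi> = x_inv * eval_diag (env_to_ring (\<phi> [x_gen]))"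
proof -
  let ?F = "\<lambda>as. env_to_ring (\<phi> as)"
  have F: "multilinear ?F" and d: "\<And>as. coboundary ?F as = 0"
    using assms by (auto simp: cocycles_env_iff cochains_env_iff)
  have "left_emb x_gen * ?F [x_inv] + right_emb x_inv * ?F [x_gen] = 0"
    using derivation_mult[OF d, of x_gen x_inv] multilinear_one[OF F, of 0 "[0]"] by simp
  then have "eval_diag (left_emb x_gen * ?F [x_inv] + right_emb x_inv * ?F [x_gen]) = 0"
    by (simp add: eval_diag.zero)
  then have "x_gen * eval_diag (?F [x_inv]) = - (x_inv * eval_diag (?F [x_gen]))"
    by (simp add: eval_diag_add eval_diag_mult eq_neg_iff_add_eq_0)
  then show ?thesis
    by (simp only: flat_alpha_1 diff_minus_eq_add fs.scale_right_distrib fscale_half_add)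
qed

text \<open>A derivation is inner exactly when its value at x is divisible by x \<otimes> 1 - 1
  \<otimes> x: the quotient f gives the inner derivation a \<mapsto> (a \<otimes> 1 - 1 \<otimes> a)
  f, which agrees with D at x and hence everywhere.\<close>

lemma coboundary_iff_flat_alpha_1:
  fixes \<phi> :: "'k::field_char_0 laurent list \<Rightarrow> _"
  assumes "\<phi> \<in> laurent.cocycles laurent.env 1"
  shows "\<phi> \<in> laurent.coboundaries laurent.env 1 \<longleftrightarrow> laurent.flat (alpha (Suc 0)) \<phi> = 0"
proof -
  let ?F = "\<lambda>as. env_to_ring (\<phi> as)"
  have ch: "\<phi> \<in> laurent.cochains laurent.env 1" and d: "\<And>as. coboundary ?F as = 0"
    using assms by (auto simp: cocycles_env_iff)
  then have F: "multilinear ?F" and deg: "\<And>as. length as \<noteq> 1 \<Longrightarrow> ?F as = 0"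
    by (auto simp: cochains_env_iff env_to_ring.zero)
  have "laurent.flat (alpha (Suc 0)) \<phi> = 0 \<longleftrightarrow> eval_diag (?F [x_gen]) = 0"
  proof -
    have "x_inv \<noteq> (0 :: 'k laurent)" using x_gen_inv(1) by (metis mult_zero_right zero_neq_one)
    then show ?thesis by (simp add: flat_alpha_1_cocycle[OF assms])
  qed
  also have "\<dots> \<longleftrightarrow> diag_gen dvd ?F [x_gen]"
    by (rule eval_diag_eq_0_iff)
  also have "\<dots> \<longleftrightarrow> \<phi> \<in> laurent.coboundaries laurent.env 1"
  proof
    assume "diag_gen dvd ?F [x_gen]"
    then obtain f where f: "?F [x_gen] = diag_gen * f" by (elim dvdE)
    have F0: "?F [a + b] = ?F [a] + ?F [b]" "?F [fscale c a] = const2 c * ?F [a]" "?F [1] = 0" for a b c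
      using multilinear_add[OF F, of 0 "[0]"] multilinear_scale[OF F, of 0 "[0]"]
        multilinear_one[OF F, of 0 "[0]"] by simp_all
    have F1: "?F [a] - (left_emb a - right_emb a) * f = 0" for a
    proof (induction a rule: laurent_induct)
      case (add a b)
      then show ?case by (simp add: F0 left_emb.add right_emb_add algebra_simps)
    next
      case (scale c a)
      then have "const2 c * (?F [a] - (left_emb a - right_emb a) * f) = 0" by simp
      then show ?case by (simp add: F0 left_emb.scale right_emb_fscale algebra_simps)
    next
      case one
      show ?case by (simp add: F0)
    next
      case (step a)
      have "?F [x_gen * a] - (left_emb (x_gen * a) - right_emb (x_gen * a)) * f
          = left_emb x_gen * (?F [a] - (left_emb a - right_emb a) * f)"
        unfolding derivation_mult[OF d, of x_gen a] f
        by (simp add: left_emb_mult right_emb_mult algebra_simps)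
      then show ?case by simp
    qed
    \<comment> \<open>The cochain of degree 0 with value f; its coboundary is the inner derivation
      above.\<close>
    let ?G = "\<lambda>as :: 'k laurent list. if as = [] then f else 0"
    show "\<phi> \<in> laurent.coboundaries laurent.env 1"
    proof (rule coboundaries_envI[OF ch, of ?G])
      show "multilinear ?G" by (auto simp: multilinear_def)
      fix as :: "'k laurent list"
      show "coboundary ?G as = ?F as"
      proof (cases "length as = 1")
        case True
        then obtain a where "as = [a]" by (auto simp: length_Suc_conv)
        with F1[of a] show ?thesis
          by (simp add: coboundary_def signed_def left_diff_distrib)
      next
        case False
        then show ?thesis by (subst coboundary_degree[of 0]) (auto simp: deg)
      qed
    qed auto
  next
    assume "\<phi> \<in> laurent.coboundaries laurent.env 1"
    then obtain \<psi> where "\<And>as. ?F as = coboundary (\<lambda>as. env_to_ring (\<psi> as)) as"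
      by (auto simp: laurent.coboundaries_def bcong_env env_to_ring_cochain_diff)
    from this[of "[x_gen]"] show "diag_gen dvd ?F [x_gen]"
      by (simp add: coboundary_def signed_def flip: left_diff_distrib)
  qed
  finally show ?thesis by simp
qed

text \<open>The difference quotient q is a derivation with q(x) = 1; each of its rules is proved by
  multiplying with \<open>diag_gen\<close> and cancelling. Its multiples realise every value of the
  pairing.\<close>

lemma flat_alpha_1_surj:
  fixes v :: "'k::field_char_0 laurent"
  shows "\<exists>\<phi>\<in>laurent.cocycles laurent.env 1. laurent.flat (alpha (Suc 0)) \<phi> = v"
proof -
  have "\<exists>r. diag_gen * r = left_emb a - right_emb a" for a :: "'k laurent"
    using diag_gen_dvd_left_right[of a] by (elim dvdE) (simp add: exI)
  then obtain q where q: "\<And>a :: 'k laurent. diag_gen * q a = left_emb a - right_emb a"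
    using choice[of "\<lambda>a r. diag_gen * r = left_emb a - right_emb (a :: 'k laurent)"] by blast
  have cancel: "r = s" if "diag_gen * r = diag_gen * s" for r s :: "'k laurent laurent"
    by (rule iffD1[OF mult_left_cancel[OF diag_gen_nonzero] that])
  have q_add: "q (a + b) = q a + q b" for a b
    by (rule cancel) (simp only: q distrib_left left_emb.add right_emb_add, simp)
  have q_scale: "q (fscale c a) = const2 c * q a" for c a
    by (rule cancel) (simp only: q left_emb.scale right_emb_fscale mult.left_commute[of diag_gen],
        simp add: right_diff_distrib)
  have q_one: "q 1 = 0" and q_x: "q x_gen = 1"
    by (rule cancel; simp only: q; simp)+
  have q_mult: "q (a * b) = left_emb a * q b + right_emb b * q a" for a b
    by (rule cancel) (simp only: q distrib_left mult.left_commute[of diag_gen],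
        simp add: left_emb_mult right_emb_mult algebra_simps)
  \<comment> \<open>The pairing of q e with \<open>alpha 1\<close> is x^-1 times the image of e
    under multiplication, so this image must be v x.\<close>
  define e where "e = right_emb (v * x_gen)"
  define F where "F as = (if length as = 1 then q (hd as) * e else 0)" for as
  have F: "multilinear F"
    unfolding multilinear_def
  proof (intro conjI allI impI)
    fix as :: "'k laurent list" and i a b c assume i: "i < length as"
    have eq: "F (as[i := d]) = (if length as = 1 then q d * e else 0)" for d
      using i by (cases as; cases i) (auto simp: F_def)
    show "F (as[i := a + b]) = F (as[i := a]) + F (as[i := b])"
      "F (as[i := fscale c a]) = const2 c * F (as[i := a])" "F (as[i := 1]) = 0"
      by (simp_all add: eq q_add q_scale q_one distrib_right mult.assoc)
  qed
  have d: "coboundary F as = 0" for as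
  proof (cases "length as = 2")
    case True
    then obtain a b where "as = [a, b]" by (auto simp: numeral_2_eq_2 length_Suc_conv)
    then show ?thesis
      by (simp add: coboundary_def merge_adjacent_def signed_def F_def q_mult algebra_simps)
  next
    case False
    then show ?thesis by (intro coboundary_degree[of 1]) (auto simp: F_def)
  qed
  let ?\<phi> = "\<lambda>as. ring_to_env (F as)"
  have "int (length as) \<noteq> 1 \<Longrightarrow> F as = 0" for as by (simp add: F_def)
  with F d have "?\<phi> \<in> laurent.cocycles laurent.env 1"
    by (simp add: cocycles_env_iff cochains_env_iff)
  moreover from this have "laurent.flat (alpha (Suc 0)) ?\<phi> = v"
    by (simp add: flat_alpha_1_cocycle F_def q_x e_def mult.left_commute[of x_inv])
  ultimately show ?thesis by blast
qed

section \<open>The cycle equation for the series alpha\<close>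

lemma hh_b_alpha:
  "laurent.hh_b (alpha (Suc m) :: 'k::field_char_0 laurent list \<Rightarrow>\<^sub>0 'k)
      - (Poly_Mapping.single (1 # alternating x_inv x_gen m) 1
        - Poly_Mapping.single (1 # alternating x_gen x_inv m) 1) \<in> laurent.hh_null"
proof -
  let ?P = "Poly_Mapping.single (1 # alternating x_inv x_gen m) (1 :: 'k)"
  let ?Q = "Poly_Mapping.single (1 # alternating x_gen x_inv m) (1 :: 'k)"
  let ?p = "Poly_Mapping.single (alternating x_inv x_gen (Suc m)) (1 :: 'k)"
  let ?q = "Poly_Mapping.single (alternating x_gen x_inv (Suc m)) (1 :: 'k)"
  \<comment> \<open>Exchanging x and x^-1 negates the boundary, so the difference of the two
    instances is twice the desired one and the factor 1/2 normalizes it.\<close>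
  have "fscale (1 / 2) ((laurent.hh_b ?p - (?P - ?Q)) - (laurent.hh_b ?q - (?Q - ?P))) \<in> laurent.hh_null"
    by (intro fs.subspace_scale fs.subspace_diff laurent.subspace_hh_null laurent.hh_b_alternating) simp_all
  also have "(laurent.hh_b ?p - (?P - ?Q)) - (laurent.hh_b ?q - (?Q - ?P))
      = (laurent.hh_b ?p - laurent.hh_b ?q) - ((?P - ?Q) + (?P - ?Q))"
    by simp
  also have "fscale (1 / 2) \<dots> = fscale (1 / 2) (laurent.hh_b ?p - laurent.hh_b ?q) - (?P - ?Q)"
    by (simp only: fs.scale_right_diff_distrib[of _ _ "_ + _"] fs.scale_right_distrib fscale_half_add)
  also have "fscale (1 / 2) (laurent.hh_b ?p - laurent.hh_b ?q) = laurent.hh_b (alpha (Suc m))"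
    by (simp add: alpha_def alternating_def[symmetric] alternating_Suc laurent.hh_b.scale laurent.hh_b.diff
        del: fscale_single)
  finally show ?thesis .
qed

lemma connes_B_alpha:
  "laurent.connes_B (alpha m :: 'k::field_char_0 laurent list \<Rightarrow>\<^sub>0 'k) = fscale (of_nat m)
     (Poly_Mapping.single (1 # alternating x_inv x_gen m) 1
        - Poly_Mapping.single (1 # alternating x_gen x_inv m) 1)"
proof (cases "m = 0")
  case True
  then show ?thesis by (simp add: alpha_def laurent.connes_B.zero)
next
  case False
  let ?P = "Poly_Mapping.single (1 # alternating x_inv x_gen m) (1 :: 'k)"
  let ?Q = "Poly_Mapping.single (1 # alternating x_gen x_inv m) (1 :: 'k)"
  have "alpha m = fscale (1 / 2) (Poly_Mapping.single (alternating x_inv x_gen m) (1::'k)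
      - Poly_Mapping.single (alternating x_gen x_inv m) 1)"
    using False by (simp add: alpha_def alternating_def)
  then have "laurent.connes_B (alpha m)
      = fscale (1 / 2) (fscale (of_nat m) (?P - ?Q) - fscale (of_nat m) (?Q - ?P))"
    using False
    by (simp only: laurent.connes_B.scale laurent.connes_B.diff laurent.connes_B_alternating)
  also have "fscale (of_nat m) (?Q - ?P) = - fscale (of_nat m) (?P - ?Q)"
    by (metis minus_diff_eq fs.scale_minus_right)
  finally show ?thesis
    by (simp only: diff_minus_eq_add fs.scale_right_distrib fscale_half_add)
qed

text \<open>At u^m the coefficients are m! for b and (m-1)! m = m! for B, so one congruence for
  b(alpha_{m+1}) is scaled by m!. At m = 0 there is no B term, and the comparison element is [1] -
  [1] = 0.\<close>

lemma hcn_diff_alpha_series: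
  "laurent.hcn_diff (alpha_series :: ('k::field_char_0 laurent list \<Rightarrow>\<^sub>0 'k) fps) \<in> laurent.hcn_null"
  unfolding laurent.hcn_null_def
proof (intro CollectI allI)
  fix m
  let ?D = "Poly_Mapping.single (1 # alternating x_inv x_gen m) (1 :: 'k)
        - Poly_Mapping.single (1 # alternating x_gen x_inv m) 1"
  have eq: "fps_nth (laurent.hcn_diff alpha_series) m
      = fscale (fact m) (laurent.hh_b (alpha (Suc m)) - ?D)"
  proof (cases m)
    case 0
    then show ?thesis by (simp add: laurent.hcn_diff_def alpha_series_def)
  next
    case (Suc l)
    then show ?thesis
      by (simp add: laurent.hcn_diff_def alpha_series_def laurent.hh_b.scale laurent.connes_B.scale
          connes_B_alpha fs.scale_right_diff_distrib mult.commute del: fscale_single of_nat_Suc)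
  qed
  show "fps_nth (laurent.hcn_diff (alpha_series :: ('k laurent list \<Rightarrow>\<^sub>0 'k) fps)) m \<in> laurent.hh_null"
    unfolding eq by (intro fs.subspace_scale laurent.subspace_hh_null hh_b_alpha)
qed

lemma alpha_chains: "n \<ge> 1 \<Longrightarrow> alpha n \<in> laurent.hh_chains (2 * int n - 1)"
  unfolding alpha_def alternating_def[symmetric]
  by (auto intro!: fs.subspace_scale fs.subspace_diff laurent.subspace_hh_chains)
    (auto simp: laurent.hh_chains_def dest: arg_cong[where f = length])

lemma alpha_series_cycles:
  "(alpha_series :: ('k::field_char_0 laurent list \<Rightarrow>\<^sub>0 'k) fps) \<in> laurent.hcn_cycles 1"
proof -
  have "fscale (fact m) (alpha (Suc m) :: 'k laurent list \<Rightarrow>\<^sub>0 'k) \<in> laurent.hh_chains (1 + 2 * int m)" for m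
    using alpha_chains[of "Suc m"] by (intro fs.subspace_scale laurent.subspace_hh_chains) (simp add: algebra_simps)
  then show ?thesis
    using hcn_diff_alpha_series by (simp add: laurent.hcn_cycles_def laurent.hcn_chains_def alpha_series_def)
qed

lemma nondegenerate_alpha_1:
  "laurent.nondegenerate 1 (alpha (Suc 0) :: 'k::field_char_0 laurent list \<Rightarrow>\<^sub>0 'k)"
proof -
  have cycle: "(alpha (Suc 0) :: 'k laurent list \<Rightarrow>\<^sub>0 'k) \<in> laurent.hh_cycles 1"
    using hh_b_alpha[of 0, where 'k = 'k] alpha_chains[of 1, where 'a = 'k]
    by (simp add: laurent.hh_cycles_def)
  have diff: "laurent.flat (alpha (Suc 0)) (u - v) = laurent.flat (alpha (Suc 0)) u - laurent.flat (alpha (Suc 0)) v"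
    for u v :: "'k laurent list \<Rightarrow> _"
    by (simp add: flat_alpha_1 env_to_ring.diff eval_diag.diff right_diff_distrib fs.scale_right_diff_distrib)
  have "induces_bij (laurent.flat (alpha (Suc 0) :: 'k laurent list \<Rightarrow>\<^sub>0 'k)) (laurent.cocycles laurent.env (p + 1))
      (laurent.coboundaries laurent.env (p + 1)) (if p = 0 then UNIV else {0}) {0}" for p
  proof (cases "p = 0")
    case True
    have "u - v \<in> laurent.coboundaries laurent.env 1
        \<longleftrightarrow> laurent.flat (alpha (Suc 0)) u - laurent.flat (alpha (Suc 0)) v = 0"
      if "u \<in> laurent.cocycles laurent.env 1" "v \<in> laurent.cocycles laurent.env 1"
      for u v :: "'k laurent list \<Rightarrow> _"
      using coboundary_iff_flat_alpha_1[OF cocycles_env_diff[OF that]] by (simp add: diff)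
    then show ?thesis
      using flat_alpha_1_surj[where 'k = 'k] True by (simp add: induces_bij_def)
  next
    case False
    \<comment> \<open>A cochain of degree p + 1 other than 1 is zero on the one-element lists at
      which the pairing evaluates it.\<close>
    have flat: "laurent.flat (alpha (Suc 0)) \<phi> = 0" if "\<phi> \<in> laurent.cocycles laurent.env (p + 1)"
      for \<phi> :: "'k laurent list \<Rightarrow> _"
      using that False
      by (simp add: flat_alpha_1 cocycles_env_iff cochains_env_iff env_to_ring.zero eval_diag.zero)
    have "\<phi> \<in> laurent.coboundaries laurent.env (p + 1)" if "\<phi> \<in> laurent.cocycles laurent.env (p + 1)"
      for \<phi> :: "'k laurent list \<Rightarrow> _"
      using that False cocycles_env_high[of "p + 1"] cocycles_env_low[of "p + 1"]
      by (cases "p > 0") auto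
    \<comment> \<open>Surjectivity onto the zero space still asks for a preimage of 0, hence for
      some cocycle.\<close>
    moreover have "(\<lambda>_. 0 :: 'k laurent \<times> 'k laurent \<Rightarrow>\<^sub>0 'k) \<in> laurent.cocycles laurent.env (p + 1)"
      by (simp add: cocycles_env_iff cochains_env_iff env_to_ring.zero multilinear_def coboundary_def)
    ultimately show ?thesis
      using False cocycles_env_diff by (auto simp: induces_bij_def flat)
  qed
  with cycle show ?thesis by (simp add: laurent.nondegenerate_def)
qed

section \<open>Smoothness\<close>

lemma bcar_free [simp]: "bcar (laurent.free_bimod m) = {v. \<forall>j\<ge>m. v j = 0}"
  and lact_free [simp]: "lact (laurent.free_bimod m) a v = (\<lambda>j. lact laurent.env a (v j))"
  and ract_free [simp]: "ract (laurent.free_bimod m) a v = (\<lambda>j. ract laurent.env a (v j))"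
  by (simp_all add: laurent.free_bimod_def)

lemma bnull_free: "bnull (laurent.free_bimod m) = {v. (\<forall>j\<ge>m. v j = 0) \<and> (\<forall>j<m. env_to_ring (v j) = 0)}"
  by (simp add: laurent.free_bimod_def laurent.env_def env_null_iff)

lemma bcong_free:
  assumes "v \<in> bcar (laurent.free_bimod m)" "w \<in> bcar (laurent.free_bimod m)"
  shows "bcong (laurent.free_bimod m) v w \<longleftrightarrow> (\<forall>j<m. env_to_ring (v j) = env_to_ring (w j))"
  using assms by (simp add: bcong_def bnull_free env_to_ring.diff)

lemma fg_projective_free: "laurent.fg_projective (laurent.free_bimod m)"
proof -
  have "laurent.is_bimodule (laurent.free_bimod m)"
    unfolding laurent.is_bimodule_def
    by (auto simp: bnull_free bcong_free env_to_ring.diff env_to_ring.add env_to_ring.zero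
        env_to_ring_lact env_to_ring_ract left_emb_mult right_emb_mult left_emb.add right_emb_add
        left_emb.scale right_emb_fscale algebra_simps)
  moreover have "bimod_hom (laurent.free_bimod m) (laurent.free_bimod m) (\<lambda>v. v)"
    by (auto simp: bimod_hom_def bcong_free)
  ultimately show ?thesis
    unfolding laurent.fg_projective_def by (auto intro!: exI[of _ m] exI[of _ "\<lambda>v. v"] simp: bcong_free)
qed

text \<open>The Koszul resolution \<open>0 \<rightarrow> A \<otimes> A \<rightarrow> A \<otimes> A \<rightarrow> A \<rightarrow> 0\<close>, whose first map is
  multiplication by \<open>x \<otimes> 1 - 1 \<otimes> x\<close>.\<close>

lemma smooth_laurent: "k_algebra.smooth (fscale :: 'k::field \<Rightarrow> 'k laurent \<Rightarrow> 'k laurent)"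
proof -
  \<comment> \<open>Rank one in degrees 0 and 1; \<open>free_bimod 0\<close> serves as the zero
    module above.\<close>
  let ?P = "\<lambda>i :: nat. laurent.free_bimod (if i \<le> 1 then 1 else 0)
    :: ('k laurent, nat \<Rightarrow> 'k laurent \<times> 'k laurent \<Rightarrow>\<^sub>0 'k) bimod"
  let ?d = "\<lambda>(i :: nat) (v :: nat \<Rightarrow> 'k laurent \<times> 'k laurent \<Rightarrow>\<^sub>0 'k) j.
    if i = 0 then lact laurent.env x_gen (v j) - ract laurent.env x_gen (v j) else 0"
  let ?\<epsilon> = "\<lambda>v :: nat \<Rightarrow> 'k laurent \<times> 'k laurent \<Rightarrow>\<^sub>0 'k. eval_diag (env_to_ring (v 0))"
  let ?e = "\<lambda>(r :: 'k laurent laurent) j :: nat. if j = 0 then ring_to_env r else 0"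
  note T = env_to_ring.diff env_to_ring.add env_to_ring.zero env_to_ring_lact env_to_ring_ract
  show ?thesis
    unfolding laurent.smooth_def
  proof (intro exI[of _ ?P] exI[of _ ?d] exI[of _ ?\<epsilon>] exI[of _ 1] conjI allI impI ballI)
    show "laurent.fg_projective (?P i)" for i
      by (rule fg_projective_free)
    show "bcar (?P i) \<subseteq> bnull (?P i)" if "1 < i" for i
      using that by (auto simp: bnull_free)
    have "bcong diag_bimod a b \<longleftrightarrow> a = b" for a b :: "'k laurent"
      by (simp add: bcong_def diag_bimod_def)
    moreover have "bcar diag_bimod = (UNIV :: 'k laurent set)" "lact diag_bimod a b = a * b"
      "ract diag_bimod a b = a * b" for a b :: "'k laurent"
      by (simp_all add: diag_bimod_def mult.commute)
    ultimately show "bimod_hom (?P 0) diag_bimod ?\<epsilon>"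
      by (auto simp: bimod_hom_def bcong_free T eval_diag.add eval_diag_mult)
    show "bimod_hom (?P (Suc i)) (?P i) (?d i)" for i
      by (cases i) (auto simp: bimod_hom_def bcong_free T algebra_simps)
    show "\<exists>v\<in>bcar (?P 0). ?\<epsilon> v = a" for a
      by (rule bexI[of _ "?e (right_emb a)"]) simp_all
    show "?\<epsilon> v = 0 \<longleftrightarrow> (\<exists>w\<in>bcar (?P 1). bcong (?P 0) (?d 0 w) v)" if v: "v \<in> bcar (?P 0)" for v
    proof -
      have key: "bcong (?P 0) (?d 0 w) v \<longleftrightarrow> diag_gen * env_to_ring (w 0) = env_to_ring (v 0)"
        if "w \<in> bcar (?P 1)" for w
        using that v by (simp add: bcong_free T left_diff_distrib)
      show ?thesis
      proof
        assume "?\<epsilon> v = 0"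
        then obtain r where "env_to_ring (v 0) = diag_gen * r"
          unfolding eval_diag_eq_0_iff by (elim dvdE)
        then show "\<exists>w\<in>bcar (?P 1). bcong (?P 0) (?d 0 w) v"
          by (intro bexI[of _ "?e r"] iffD2[OF key]) simp_all
      next
        assume "\<exists>w\<in>bcar (?P 1). bcong (?P 0) (?d 0 w) v"
        then obtain w where w: "w \<in> bcar (?P 1)" "bcong (?P 0) (?d 0 w) v" by (elim bexE)
        from iffD1[OF key[OF w(1)] w(2)] show "?\<epsilon> v = 0"
          unfolding eval_diag_eq_0_iff by (rule dvdI[OF sym])
      qed
    qed
    \<comment> \<open>For i = 0 this is injectivity of multiplication by \<open>diag_gen\<close> in
      a domain; for larger i the module \<open>?P (Suc i)\<close> is zero and both sides
      hold.\<close>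
    show "bcong (?P i) (?d i v) 0 \<longleftrightarrow> (\<exists>w\<in>bcar (?P (Suc (Suc i))). bcong (?P (Suc i)) (?d (Suc i) w) v)"
      if v: "v \<in> bcar (?P (Suc i))" for i v
    proof (cases i)
      case 0
      have "bcong (?P 0) (?d 0 v) 0 \<longleftrightarrow> diag_gen * env_to_ring (v 0) = 0"
        using v 0 by (simp add: bcong_free T left_diff_distrib)
      also have "\<dots> \<longleftrightarrow> env_to_ring (v 0) = 0"
        using mult_eq_0_iff diag_gen_nonzero by blast
      also have "\<dots> \<longleftrightarrow> (\<exists>w\<in>bcar (?P 2). bcong (?P 1) (?d 1 w) v)"
        using v 0 by (auto simp: bcong_free T)
      finally show ?thesis using 0 by (simp add: numeral_2_eq_2)
    next
      case (Suc l)
      then show ?thesis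
        using v by (auto simp: bcong_free T)
    qed
  qed
qed

section \<open>The differential form of alpha_1\<close>

lemma hkr1_alpha_1:
  "laurent.hkr1 (alpha (Suc 0) :: 'k::field_char_0 laurent list \<Rightarrow>\<^sub>0 'k) - Poly_Mapping.single x_gen x_inv
     \<in> laurent.kahler_null"
proof -
  let ?h = "fscale (1 / 2) (1 :: 'k laurent)"
  have half: "?h * a = fscale (1 / 2) a" for a by (simp add: laurent.scale_mult_left)
  have 1: "laurent.hkr1 (alpha (Suc 0) :: 'k laurent list \<Rightarrow>\<^sub>0 'k)
      = Poly_Mapping.single x_gen (?h * x_inv) - Poly_Mapping.single x_inv (?h * x_gen)"
    unfolding alpha_1 by (simp add: fs.scale_right_diff_distrib laurent.hkr1.diff laurent.hkr1_single half)
  have 2: "Poly_Mapping.single x_gen x_inv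
      = Poly_Mapping.single x_gen (?h * x_inv) + Poly_Mapping.single x_gen (?h * x_inv)"
    by (simp only: single_add[symmetric] half fscale_half_add)
  \<comment> \<open>The difference is half of the Leibniz relation for x x^-1 minus half of d(1),
    that is, x d(x^-1) = - x^-1 dx modulo relations.\<close>
  have "laurent.hkr1 (alpha (Suc 0) :: 'k laurent list \<Rightarrow>\<^sub>0 'k) - Poly_Mapping.single x_gen x_inv
      = (Poly_Mapping.single (x_gen * x_inv) ?h - Poly_Mapping.single x_inv (?h * x_gen)
          - Poly_Mapping.single x_gen (?h * x_inv)) - Poly_Mapping.single (fscale 1 1) ?h"
    unfolding 1 2 by simp
  also have "\<dots> \<in> laurent.kahler_null"
    by (intro kahler_module.subspace_diff laurent.subspace_kahler_null laurent.kahler_null_mult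
        laurent.kahler_null_unit)
  finally show ?thesis .
qed

theorem mainTheorem2:
  shows "(\<forall>n\<ge>1. (alpha n :: 'k::field_char_0 laurent list \<Rightarrow>\<^sub>0 'k) \<in> laurent.hh_chains (2 * int n - 1)) \<and>
    ((alpha_series :: ('k laurent list \<Rightarrow>\<^sub>0 'k) fps) \<in> laurent.hcn_chains 1) \<and>
    (laurent.hcn_diff (alpha_series :: ('k laurent list \<Rightarrow>\<^sub>0 'k) fps) \<in> laurent.hcn_null) \<and>
    (laurent.hcn_natural (alpha_series :: ('k laurent list \<Rightarrow>\<^sub>0 'k) fps) = alpha 1) \<and>
    ((alpha 1 :: 'k laurent list \<Rightarrow>\<^sub>0 'k) =
           fscale (1 / 2) (Poly_Mapping.single [x_inv, x_gen] 1 - Poly_Mapping.single [x_gen, x_inv] 1)) \<and>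
    (laurent.nondegenerate 1 (alpha 1 :: 'k laurent list \<Rightarrow>\<^sub>0 'k)) \<and>
    (laurent.calabi_yau_structure 1 (alpha_series :: ('k laurent list \<Rightarrow>\<^sub>0 'k) fps)) \<and>
    (induces_bij (laurent.hkr1 :: ('k laurent list \<Rightarrow>\<^sub>0 'k) \<Rightarrow> ('k laurent \<Rightarrow>\<^sub>0 'k laurent))
           (laurent.hh_cycles 1) (laurent.hh_boundaries 1) UNIV laurent.kahler_null) \<and>
    (laurent.hkr1 (alpha 1 :: 'k laurent list \<Rightarrow>\<^sub>0 'k) - Poly_Mapping.single x_gen x_inv
           \<in> laurent.kahler_null)"
proof -
  have natural: "laurent.hcn_natural (alpha_series :: ('k laurent list \<Rightarrow>\<^sub>0 'k) fps) = alpha (Suc 0)"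
    by (simp add: laurent.hcn_natural_def alpha_series_def)
  have "laurent.calabi_yau_structure 1 (alpha_series :: ('k laurent list \<Rightarrow>\<^sub>0 'k) fps)"
    unfolding laurent.calabi_yau_structure_def natural
    by (intro conjI smooth_laurent alpha_series_cycles nondegenerate_alpha_1)
  moreover have "(alpha_series :: ('k laurent list \<Rightarrow>\<^sub>0 'k) fps) \<in> laurent.hcn_chains 1"
    using alpha_series_cycles[where 'k = 'k] by (simp add: laurent.hcn_cycles_def)
  ultimately show ?thesis
    unfolding One_nat_def
    by (intro conjI allI impI alpha_chains hcn_diff_alpha_series natural alpha_1 nondegenerate_alpha_1
        laurent.hkr1_iso hkr1_alpha_1) auto
qed

end
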